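(* Let $F$ be a fullerene with $n$ vertices. Then \[ c(F)\le \begin{cases} \lfloor n/6\rfloor-3, & n\equiv 2 \pmod 6,\\ \lfloor n/6\rfloor-2, & \text{otherwise.}\end{cases} \]
   Context: A fullerene is a finite, trivalent (3-regular) plane graph all of whose faces are pentagons and hexagons. A perfect matching of a graph is a set of edges such that every vertex is incident with exactly one of them. For a perfect matching $M$ of $F$, a face is alternating with respect to $M$ if exactly half of its boundary edges lie in $M$. A resonant pattern of $F$ is a set of pairwise vertex-disjoint faces that are all alternating with respect to one common perfect matching of $F$. The Clar number $c(F)$ is the maximum size of a resonant pattern of $F$. *)

theory Defs
  imports "HOL-Analysis.Analysis"
begin

text \<open>
  The plane is identified with \<^typ>\<open>complex\<close>. A plane graph is a pair \<open>(V, E)\<close> of a finite set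
  of points and a finite set of edges, each edge being the point set of an arc joining two distinct
  vertices. The ends of an edge \<open>e\<close> are the points of \<open>e \<inter> V\<close>, so that a vertex \<open>v\<close> and an edge \<open>e\<close>
  are incident iff \<open>v \<in> e\<close>. The third condition excludes parallel edges; loops are excluded
  because an arc is injective.
\<close>

definition plane_graph :: "complex set \<Rightarrow> complex set set \<Rightarrow> bool" where
  "plane_graph V E \<longleftrightarrow>
     finite V \<and> finite E \<and>
     (\<forall>e\<in>E. \<exists>g. arc g \<and> path_image g = e \<and> e \<inter> V = {pathstart g, pathfinish g}) \<and>
     (\<forall>e\<in>E. \<forall>e'\<in>E. e \<inter> V = e' \<inter> V \<longrightarrow> e = e') \<and>
     (\<forall>e\<in>E. \<forall>e'\<in>E. e \<noteq> e' \<longrightarrow> e \<inter> e' \<subseteq> V)"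

definition trivalent :: "complex set \<Rightarrow> complex set set \<Rightarrow> bool" where
  "trivalent V E \<longleftrightarrow> (\<forall>v\<in>V. card {e\<in>E. v \<in> e} = 3)"

text \<open>The unbounded component of the complement is a face like any other.\<close>

definition faces :: "complex set \<Rightarrow> complex set set \<Rightarrow> complex set set" where
  "faces V E = components (- (V \<union> \<Union>E))"

definition face_vertices :: "complex set \<Rightarrow> complex set \<Rightarrow> complex set" where
  "face_vertices V f = V \<inter> frontier f"

definition face_edges :: "complex set set \<Rightarrow> complex set \<Rightarrow> complex set set" where
  "face_edges E f = {e\<in>E. e \<subseteq> frontier f}"

text \<open>
  The boundary of \<open>f\<close> is a cycle of length \<open>k\<close> of the graph (used for \<open>k \<ge> 3\<close>, where distinctness of
  the vertices \<open>v 0, \<dots>, v (k - 1)\<close> forces the edges to be distinct as well).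
\<close>

definition face_is_polygon ::
    "complex set \<Rightarrow> complex set set \<Rightarrow> nat \<Rightarrow> complex set \<Rightarrow> bool" where
  "face_is_polygon V E k f \<longleftrightarrow>
     (\<exists>v e. inj_on v {..<k} \<and>
        (\<forall>i<k. e i \<in> E \<and> e i \<inter> V = {v i, v (Suc i mod k)}) \<and>
        frontier f = (\<Union>i<k. e i))"

definition fullerene :: "complex set \<Rightarrow> complex set set \<Rightarrow> bool" where
  "fullerene V E \<longleftrightarrow>
     plane_graph V E \<and> trivalent V E \<and>
     (\<forall>f\<in>faces V E. face_is_polygon V E 5 f \<or> face_is_polygon V E 6 f)"

definition perfect_matching :: "complex set \<Rightarrow> complex set set \<Rightarrow> complex set set \<Rightarrow> bool" where
  "perfect_matching V E M \<longleftrightarrow> M \<subseteq> E \<and> (\<forall>v\<in>V. \<exists>!e. e \<in> M \<and> v \<in> e)"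

definition alternating_face :: "complex set set \<Rightarrow> complex set set \<Rightarrow> complex set \<Rightarrow> bool" where
  "alternating_face E M f \<longleftrightarrow> 2 * card (face_edges E f \<inter> M) = card (face_edges E f)"

definition resonant_pattern :: "complex set \<Rightarrow> complex set set \<Rightarrow> complex set set \<Rightarrow> bool" where
  "resonant_pattern V E P \<longleftrightarrow>
     P \<subseteq> faces V E \<and>
     pairwise (\<lambda>f g. disjnt (face_vertices V f) (face_vertices V g)) P \<and>
     (\<exists>M. perfect_matching V E M \<and> (\<forall>f\<in>P. alternating_face E M f))"

text \<open>
  On \<^typ>\<open>nat\<close>, \<open>Sup\<close> is the maximum of a nonempty finite set, and \<open>0\<close> for the empty set; the latter
  would only matter for a graph without perfect matchings.
\<close>

definition clar_number :: "complex set \<Rightarrow> complex set set \<Rightarrow> nat" where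
  "clar_number V E = Sup {card P | P. resonant_pattern V E P}"

end

theory Submission imports Defs begin

text \<open>
  Every face boundary, and more generally every cycle of the graph, is a Jordan curve. By
  Janiszewski's theorem each side of the curve contains exactly one of the faces at any given edge
  of the cycle. Hence every edge lies on exactly two faces, and every even subgraph, being a sum of
  cycles, is the cut between two classes of faces. Counting even subgraphs then gives
  \<open>|V| - |E| + |F| \<ge> 2\<close>, and the number of pentagons is six times this Euler
  characteristic.

  Let \<open>P\<close> be a resonant pattern with perfect matching \<open>M\<close>, \<open>U\<close> the set of vertices not on \<open>P\<close>,
  and \<open>Z\<close> the set of edges on \<open>P\<close> or in \<open>M\<close>. A vertex of \<open>U\<close> is a defect of the face opposite to
  its matching edge. The number of defects of a face off \<open>P\<close> has the parity of its length, so
  that every pentagon has a defect, and \<open>|U|\<close> is at least the number of pentagons, hence at least 12.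

  If \<open>n\<close> is 2 modulo 6, then \<open>|U|\<close> is 14 or at least 20. If \<open>|U| = 14\<close>, all faces off \<open>P\<close> have three
  edges off \<open>Z\<close>, except one, which has four. But the edges off \<open>Z\<close> belong to a cut, so that the two
  classes of faces off \<open>P\<close> have equally many of them, a contradiction modulo 3.
\<close>

section \<open>Cycles and faces of a plane graph\<close>

text \<open>On a disc inside the image, the inverse of \<open>g\<close> would be a continuous
  injection into the reals. Deleting a point leaves the disc connected, but deleting an intermediate
  value disconnects an interval. The lemma supplies points off the graph near every edge.\<close>

lemma interior_arc_image_empty:
  fixes g :: "real \<Rightarrow> complex"
  assumes "arc g"
  shows "interior (path_image g) = {}"
proof (rule ccontr)
  assume "interior (path_image g) \<noteq> {}"
  then obtain z r where r: "r > 0" "ball z r \<subseteq> path_image g"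
    by (meson ex_in_conv mem_interior)
  let ?B = "ball z r"
  obtain h where h: "homeomorphism {0..1} (path_image g) g h"
    using homeomorphism_arc[OF assms] by blast
  have conth: "continuous_on ?B h"
    using h r(2) by (meson continuous_on_subset homeomorphism_def)
  have injh: "inj_on h ?B"
    by (rule inj_on_inverseI[of _ g]) (use h r(2) homeomorphism_apply2 in blast)
  have conn: "connected (h ` (?B - {p}))" for p
    by (intro connected_continuous_image continuous_on_subset[OF conth] connected_open_delete) auto
  have connB: "connected (h ` ?B)"
    by (intro connected_continuous_image conth) auto
  obtain a b where ab: "a \<in> ?B" "b \<in> ?B" "h a < h b"
  proof -
    have "z \<in> ?B" "z + of_real (r/2) \<in> ?B" "z \<noteq> z + of_real (r/2)"
      using r(1) by (auto simp: dist_norm)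
    then show ?thesis
      using injh that by (metis inj_on_eq_iff linorder_neqE_linordered_idom)
  qed
  define m where "m = (h a + h b) / 2"
  have m: "h a < m" "m < h b"
    using ab by (auto simp: m_def)
  then have "m \<in> h ` ?B"
    using connectedD_interval[OF connB, of "h a" "h b" m] ab by auto
  then obtain p where p: "p \<in> ?B" "h p = m"
    by auto
  have "a \<noteq> p" "b \<noteq> p"
    using p m by auto
  then have "m \<in> h ` (?B - {p})"
    using connectedD_interval[OF conn[of p], of "h a" "h b" m] ab m by auto
  then show False
    using p injh by (auto simp: inj_on_eq_iff)
qed

lemma plane_graphD:
  assumes "plane_graph V E"
  shows "finite V" "finite E"
    and "\<And>e e'. \<lbrakk>e \<in> E; e' \<in> E; e \<inter> V = e' \<inter> V\<rbrakk> \<Longrightarrow> e = e'"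
    and "\<And>e e'. \<lbrakk>e \<in> E; e' \<in> E; e \<noteq> e'\<rbrakk> \<Longrightarrow> e \<inter> e' \<subseteq> V"
  using assms by (auto simp: plane_graph_def)

lemma plane_graph_edge_arc:
  assumes "plane_graph V E" "e \<in> E" "e \<inter> V = {a, b}"
  obtains g where "arc g" "path_image g = e" "pathstart g = a" "pathfinish g = b"
proof -
  obtain g where g: "arc g" "path_image g = e" "e \<inter> V = {pathstart g, pathfinish g}"
    using assms by (auto simp: plane_graph_def)
  then consider "pathstart g = a" "pathfinish g = b" | "pathstart g = b" "pathfinish g = a"
    using assms(3) by (auto simp: doubleton_eq_iff)
  then show ?thesis
  proof cases
    case 2
    show ?thesis
      by (rule that[of "reversepath g"]) (use g 2 in \<open>auto simp: arc_reversepath\<close>)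
  qed (use g that in blast)
qed

lemma plane_graph_edge:
  assumes "plane_graph V E" "e \<in> E"
  shows "compact e" "card (e \<inter> V) = 2" "e - V \<noteq> {}" "interior e = {}"
proof -
  obtain g where g: "arc g" "path_image g = e" "e \<inter> V = {pathstart g, pathfinish g}"
    using assms by (auto simp: plane_graph_def)
  show "compact e" "interior e = {}"
    using g compact_arc_image interior_arc_image_empty by auto
  show "card (e \<inter> V) = 2"
    using g arc_distinct_ends[OF g(1)] by (simp add: eq_commute)
  have "infinite e"
    using g finite_imageD[of g "{0..1}"] infinite_Icc[of 0 "1::real"]
    by (auto simp: arc_def path_image_def)
  then show "e - V \<noteq> {}"
    using assms plane_graphD(1) by (metis Diff_eq_empty_iff finite_subset)
qed

text \<open>This form serves twice: the remaining arc and the removed edge close up to a Jordan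
  curve, and the arc itself is the connected intersection that Janiszewski's theorem requires at
  that edge.\<close>

definition plane_cycle :: "complex set \<Rightarrow> complex set set \<Rightarrow> complex set set \<Rightarrow> bool" where
  "plane_cycle V E Q \<longleftrightarrow> Q \<subseteq> E \<and> Q \<noteq> {} \<and>
     (\<forall>e\<in>Q. \<exists>p. arc p \<and> path_image p = \<Union>(Q - {e}) \<and> {pathstart p, pathfinish p} = e \<inter> V)"

text \<open>Distinct edges meet only in vertices, so an edge and the complementary arc share just
  their two ends and join to a simple closed curve.\<close>

lemma plane_cycle_Jordan:
  assumes pg: "plane_graph V E" and Q: "plane_cycle V E Q"
  shows "inside (\<Union>Q) \<union> outside (\<Union>Q) = - \<Union>Q" "inside (\<Union>Q) \<inter> outside (\<Union>Q) = {}"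
    and "S \<in> {inside (\<Union>Q), outside (\<Union>Q)} \<Longrightarrow> open S \<and> connected S \<and> frontier S = \<Union>Q"
proof -
  obtain e where e: "e \<in> Q" "e \<in> E"
    using Q by (auto simp: plane_cycle_def)
  then obtain p where p: "arc p" "path_image p = \<Union>(Q - {e})" "{pathstart p, pathfinish p} = e \<inter> V"
    using Q unfolding plane_cycle_def by blast
  obtain g where g: "arc g" "path_image g = e" "pathstart g = pathfinish p" "pathfinish g = pathstart p"
    using plane_graph_edge_arc[OF pg e(2), of "pathfinish p" "pathstart p"] p by (metis insert_commute)
  have un: "\<Union>Q = path_image p \<union> path_image g"
    using p g e by auto
  have "path_image p \<inter> path_image g \<subseteq> V"
  proof
    fix z assume "z \<in> path_image p \<inter> path_image g"
    then obtain d where "d \<in> Q" "d \<noteq> e" "z \<in> d \<inter> e"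
      using p g by auto
    moreover have "d \<in> E"
      using Q \<open>d \<in> Q\<close> by (auto simp: plane_cycle_def)
    ultimately show "z \<in> V"
      using plane_graphD(4)[OF pg, of d e] e by auto
  qed
  then have "path_image p \<inter> path_image g \<subseteq> {pathstart p, pathstart g}"
    using p g by auto
  then have sp: "simple_path (p +++ g)" "pathfinish (p +++ g) = pathstart (p +++ g)"
    using simple_path_join_loop[OF p(1) g(1)] g by auto
  have "path_image (p +++ g) = \<Union>Q"
    using un g by (simp add: path_image_join)
  then show "inside (\<Union>Q) \<union> outside (\<Union>Q) = - \<Union>Q" "inside (\<Union>Q) \<inter> outside (\<Union>Q) = {}"
    and "S \<in> {inside (\<Union>Q), outside (\<Union>Q)} \<Longrightarrow> open S \<and> connected S \<and> frontier S = \<Union>Q"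
    using Jordan_inside_outside[OF sp] by auto
qed

text \<open>Passes from cyclically indexed polygons to \<open>plane_cycle\<close>, both for face
  boundaries and for cycles found in even subgraphs. Rotating the indices makes any given edge the
  last one, so it suffices to build arcs along initial segments.\<close>

lemma polygon_plane_cycle:
  assumes pg: "plane_graph V E" and k: "k \<ge> 3" and inj: "inj_on v {..<k}"
    and e: "\<And>i. i < k \<Longrightarrow> e i \<in> E \<and> e i \<inter> V = {v i, v (Suc i mod k)}"
  shows "plane_cycle V E (e ` {..<k})" "inj_on e {..<k}"
    and "\<And>x. x \<in> V \<Longrightarrow> card {q \<in> e ` {..<k}. x \<in> q} \<in> {0, 2}"
proof -
  have veq: "v i = v j \<longleftrightarrow> i = j" if "i < k" "j < k" for i j
    using inj that by (auto simp: inj_on_def)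
  have sk: "Suc i mod k < k" for i
    using k by auto
  have smod: "Suc i mod k = (if Suc i = k then 0 else Suc i)" if "i < k" for i
    using that by auto
  \<comment> \<open>Equal end pairs at distinct indices would make each index the successor of the
    other modulo \<open>k\<close>, which \<open>k \<ge> 3\<close> excludes.\<close>
  show inje: "inj_on e {..<k}"
  proof (rule inj_onI)
    fix i j assume ij: "i \<in> {..<k}" "j \<in> {..<k}" "e i = e j"
    then have "{v i, v (Suc i mod k)} = {v j, v (Suc j mod k)}"
      using e[of i] e[of j] by auto
    then have "i = j \<or> i = Suc j mod k \<and> Suc i mod k = j"
      using ij veq sk by (auto simp: doubleton_eq_iff)
    then show "i = j"
      using ij k by (auto simp: smod split: if_splits)
  qed
  \<comment> \<open>General \<open>v'\<close> and \<open>e'\<close> allow a use after rotation;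
    \<open>m < k\<close> keeps the path from closing up.\<close>
  have arcs: "\<exists>p. arc p \<and> path_image p = \<Union>(e' ` {..<m}) \<and> pathstart p = v' 0 \<and> pathfinish p = v' m"
    if "0 < m" "m < k" and inj': "inj_on v' {..<k}" "inj_on e' {..<k}"
      and e': "\<And>i. i < k \<Longrightarrow> e' i \<in> E \<and> e' i \<inter> V = {v' i, v' (Suc i mod k)}" for m v' e'
    using that(1,2)
  proof (induction m)
    case (Suc m)
    have m: "m < k" "Suc m mod k = Suc m"
      using Suc by auto
    obtain g where g: "arc g" "path_image g = e' m" "pathstart g = v' m" "pathfinish g = v' (Suc m)"
      using plane_graph_edge_arc[OF pg, of "e' m"] e'[of m] m by metis
    show ?case
    proof (cases "m = 0")
      case True
      then show ?thesis
        using g by (auto simp: lessThan_Suc)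
    next
      case False
      then obtain p where p: "arc p" "path_image p = \<Union>(e' ` {..<m})" "pathstart p = v' 0" "pathfinish p = v' m"
        using Suc by auto
      have "path_image p \<inter> path_image g \<subseteq> {v' m}"
      proof
        fix z assume "z \<in> path_image p \<inter> path_image g"
        then obtain i where i: "i < m" "z \<in> e' i" "z \<in> e' m"
          using p g by auto
        have "e' i \<noteq> e' m"
          using i m inj_onD[OF inj'(2), of i m] by auto
        then have "e' i \<inter> e' m \<subseteq> V"
          using i m e' plane_graphD(4)[OF pg] by (meson less_trans)
        then have "z \<in> V"
          using i by auto
        then have "z \<in> e' i \<inter> V" "z \<in> e' m \<inter> V"
          using i by auto
        then have "z \<in> {v' i, v' (Suc i)}" "z \<in> {v' m, v' (Suc m)}"
          using i m e'[of i] e'[of m] by auto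
        moreover have "v' i \<noteq> v' (Suc m)" "v' (Suc i) \<noteq> v' (Suc m)"
          using inj_onD[OF inj'(1), of i "Suc m"] inj_onD[OF inj'(1), of "Suc i" "Suc m"] i m Suc.prems
          by auto
        ultimately show "z \<in> {v' m}"
          by blast
      qed
      then have "arc (p +++ g)"
        using p g by (intro arc_join) auto
      moreover have "path_image (p +++ g) = \<Union>(e' ` {..<Suc m})"
        using p g by (auto simp: path_image_join lessThan_Suc)
      ultimately show ?thesis
        using p g by (intro exI[of _ "p +++ g"]) auto
    qed
  qed simp
  show "plane_cycle V E (e ` {..<k})"
    unfolding plane_cycle_def
  proof (intro conjI ballI)
    show "e ` {..<k} \<subseteq> E" "e ` {..<k} \<noteq> {}"
      using e k by (auto simp: lessThan_empty_iff)
    fix d assume "d \<in> e ` {..<k}"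
    then obtain j where j: "j < k" "d = e j"
      by auto
    \<comment> \<open>The rotation sends the last index \<open>k - 1\<close> to \<open>j\<close>, so
      the first \<open>k - 1\<close> rotated edges are all edges except \<open>d\<close>.\<close>
    define r where "r i = (i + Suc j) mod k" for i
    have bij: "bij_betw r {..<k} {..<k}"
    proof -
      have "inj_on r {..<k}"
      proof (rule inj_onI)
        fix a b assume "a \<in> {..<k}" "b \<in> {..<k}" "r a = r b"
        moreover have "r i = (if i + Suc j < k then i + Suc j else i + Suc j - k)" if "i < k" for i
          using that j by (simp add: r_def le_mod_geq)
        ultimately show "a = b"
          by (auto split: if_splits)
      qed
      moreover have "r ` {..<k} \<subseteq> {..<k}"
        using k by (auto simp: r_def)
      ultimately show ?thesis
        by (simp add: bij_betw_def endo_inj_surj)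
    qed
    have "inj_on (v \<circ> r) {..<k}" "inj_on (e \<circ> r) {..<k}"
      using bij inj inje by (auto simp: bij_betw_def intro!: comp_inj_on)
    moreover have "(e \<circ> r) i \<in> E \<and> (e \<circ> r) i \<inter> V = {(v \<circ> r) i, (v \<circ> r) (Suc i mod k)}" if "i < k" for i
    proof -
      have "r i < k"
        using k by (simp add: r_def)
      moreover have "Suc (r i) mod k = r (Suc i mod k)"
        unfolding r_def mod_Suc_eq mod_add_left_eq by simp
      ultimately show ?thesis
        using e[of "r i"] by simp
    qed
    ultimately obtain p where p: "arc p" "path_image p = \<Union>((e \<circ> r) ` {..<k-1})"
        "pathstart p = v (r 0)" "pathfinish p = v (r (k - 1))"
      using arcs[of "k-1" "v \<circ> r" "e \<circ> r"] k by auto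
    have rk: "r (k - 1) = j"
      using j k by (simp add: r_def)
    have "r ` {..<k-1} = {..<k} - {j}"
    proof -
      have "{..<k-1} = {..<k} - {k-1}"
        by auto
      then have "r ` {..<k-1} = r ` {..<k} - r ` {k-1}"
        using bij k by (subst inj_on_image_set_diff[symmetric, of r "{..<k}"]) (auto simp: bij_betw_def)
      then show ?thesis
        using bij rk by (simp add: bij_betw_def)
    qed
    then have "(e \<circ> r) ` {..<k-1} = e ` ({..<k} - {j})"
      by (metis image_comp)
    also have "\<dots> = e ` {..<k} - e ` {j}"
      using j by (intro inj_on_image_set_diff[OF inje]) auto
    finally have "(e \<circ> r) ` {..<k-1} = e ` {..<k} - {d}"
      using j by simp
    moreover have "{pathstart p, pathfinish p} = d \<inter> V"
      using p rk j e[of j] r_def[of 0] by (simp add: insert_commute)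
    ultimately show "\<exists>p. arc p \<and> path_image p = \<Union>(e ` {..<k} - {d}) \<and> {pathstart p, pathfinish p} = d \<inter> V"
      using p(1,2) by metis
  qed
  show "card {q \<in> e ` {..<k}. x \<in> q} \<in> {0, 2}" if "x \<in> V" for x
  proof (cases "\<exists>j<k. x = v j")
    case False
    have "x \<notin> e i" if "i < k" for i
    proof
      assume "x \<in> e i"
      then have "x \<in> {v i, v (Suc i mod k)}"
        using e[OF that] \<open>x \<in> V\<close> by blast
      then show False
        using False that sk by auto
    qed
    then have "{q \<in> e ` {..<k}. x \<in> q} = {}"
      by blast
    then show ?thesis by simp
  next
    case True
    then obtain j where j: "j < k" "x = v j" by auto
    \<comment> \<open>The cyclic predecessor of \<open>j\<close>: the edges at \<open>v j\<close>
      are exactly \<open>e j\<close> and \<open>e j'\<close>.\<close>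
    define j' where "j' = (if j = 0 then k - 1 else j - 1)"
    have j': "j' < k" "j' \<noteq> j"
      using j k by (auto simp: j'_def)
    have "x \<in> e i \<longleftrightarrow> i = j \<or> i = j'" if "i < k" for i
    proof -
      have "x \<in> e i \<longleftrightarrow> x \<in> {v i, v (Suc i mod k)}"
        using e[OF that] \<open>x \<in> V\<close> by blast
      also have "\<dots> \<longleftrightarrow> i = j \<or> j = Suc i mod k"
        using veq j sk that by auto
      also have "j = Suc i mod k \<longleftrightarrow> i = j'"
        using smod[OF that] that j by (auto simp: j'_def)
      finally show ?thesis .
    qed
    then have "{q \<in> e ` {..<k}. x \<in> q} = e ` {j, j'}"
      using j j' by auto
    also have "card \<dots> = card {j, j'}"
      using j j' by (intro card_image inj_on_subset[OF inje]) auto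
    finally show ?thesis
      using j' by simp
  qed
qed

section \<open>Faces near an edge and on the sides of a cycle\<close>

lemma plane_graph_closed:
  assumes "plane_graph V E" "D \<subseteq> E"
  shows "compact (V \<union> \<Union>D)" "compact (\<Union>D)"
proof -
  have "finite D"
    using assms plane_graphD(2) finite_subset by blast
  then show "compact (\<Union>D)"
    using assms plane_graph_edge(1) by (intro compact_Union) auto
  then show "compact (V \<union> \<Union>D)"
    using plane_graphD(1)[OF assms(1)] by (simp add: compact_Un finite_imp_compact)
qed

lemma faces_properties:
  assumes pg: "plane_graph V E" and f: "f \<in> faces V E"
  shows "connected f" "f \<inter> (V \<union> \<Union>E) = {}" "f \<noteq> {}" "frontier f \<subseteq> V \<union> \<Union>E"
proof -
  have cl: "closed (V \<union> \<Union>E)"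
    using plane_graph_closed[OF pg subset_refl] compact_imp_closed by blast
  note f' = f[unfolded faces_def]
  show "connected f" "f \<noteq> {}"
    using in_components_connected[OF f'] in_components_nonempty[OF f'] .
  show "f \<inter> (V \<union> \<Union>E) = {}"
    using in_components_subset[OF f'] by blast
  show "frontier f \<subseteq> V \<union> \<Union>E"
    using f cl frontier_of_components_closed_complement unfolding faces_def by blast
qed

lemma face_through_point:
  assumes "x \<notin> V \<union> \<Union>E"
  obtains f where "f \<in> faces V E" "x \<in> f"
proof
  show "connected_component_set (- (V \<union> \<Union>E)) x \<in> faces V E"
    unfolding faces_def using assms by (intro componentsI) simp
  show "x \<in> connected_component_set (- (V \<union> \<Union>E)) x"
    using assms by (simp add: connected_component_refl_eq)
qed

lemma edge_point_ball:
  assumes pg: "plane_graph V E" and "e \<in> E" "x \<in> e - V"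
  obtains r where "r > 0" "ball x r \<inter> (V \<union> \<Union>(E - {e})) = {}"
proof -
  have "open (- (V \<union> \<Union>(E - {e})))"
    using plane_graph_closed(1)[OF pg, of "E - {e}"] compact_imp_closed by blast
  moreover have "x \<notin> V \<union> \<Union>(E - {e})"
    using assms plane_graphD(4)[OF pg] by blast
  ultimately obtain r where "r > 0" "ball x r \<subseteq> - (V \<union> \<Union>(E - {e}))"
    using open_contains_ball by (metis ComplI)
  then show ?thesis
    using that by blast
qed

text \<open>The ball is connected and its centre \<open>x\<close> is not in \<open>f\<close>, so it
  contains a frontier point of \<open>f\<close>. That point belongs to the graph, and within the
  ball the graph consists of points of \<open>e\<close> off \<open>V\<close>.\<close>

lemma face_meets_edge_ball:
  assumes pg: "plane_graph V E" and e: "e \<in> E" "x \<in> e - V"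
    and r: "ball x r \<inter> (V \<union> \<Union>(E - {e})) = {}"
    and f: "f \<in> faces V E" "f \<inter> ball x r \<noteq> {}"
  shows "(e - V) \<inter> frontier f \<noteq> {}"
proof -
  have "r > 0"
    using f(2) by (metis Int_empty_right ball_eq_empty not_le)
  then have "ball x r - f \<noteq> {}"
    using e faces_properties(2)[OF pg f(1)] by force
  then obtain y where y: "y \<in> ball x r" "y \<in> frontier f"
    using connected_Int_frontier[of "ball x r" f] f(2) by (auto simp: Int_commute)
  then have "y \<in> V \<union> \<Union>E"
    using faces_properties(4)[OF pg f(1)] by blast
  then show ?thesis
    using y r by blast
qed

lemma face_side_of_cycle:
  assumes pg: "plane_graph V E" and Q: "plane_cycle V E Q" and f: "f \<in> faces V E"
  shows "f \<subseteq> inside (\<Union>Q) \<or> f \<subseteq> outside (\<Union>Q)"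
proof -
  have "f \<subseteq> inside (\<Union>Q) \<union> outside (\<Union>Q)"
    using faces_properties(2)[OF pg f] Q plane_cycle_Jordan(1)[OF pg Q] by (auto simp: plane_cycle_def)
  moreover have "open (inside (\<Union>Q))" "open (outside (\<Union>Q))"
    using plane_cycle_Jordan(3)[OF pg Q] by auto
  moreover have "inside (\<Union>Q) \<inter> outside (\<Union>Q) \<inter> f = {}"
    using plane_cycle_Jordan(2)[OF pg Q] by simp
  ultimately have "inside (\<Union>Q) \<inter> f = {} \<or> outside (\<Union>Q) \<inter> f = {}"
    using connectedD[OF faces_properties(1)[OF pg f]] by metis
  then show ?thesis
    using \<open>f \<subseteq> inside (\<Union>Q) \<union> outside (\<Union>Q)\<close> by blast
qed

section \<open>The two faces at an edge, and cycles as cuts\<close>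

locale fullerene_graph =
  fixes V :: "complex set" and E :: "complex set set"
  assumes fullerene: "fullerene V E"
begin

lemma plane: "plane_graph V E"
  using fullerene by (simp add: fullerene_def)

lemma face_boundary:
  assumes "f \<in> faces V E"
  shows "plane_cycle V E (face_edges E f)" "\<Union>(face_edges E f) = frontier f"
    and "card (face_edges E f) \<in> {5, 6}"
    and "x \<in> V \<Longrightarrow> card {e \<in> face_edges E f. x \<in> e} \<in> {0, 2}"
proof -
  obtain k where k: "k \<in> {5, 6}" "face_is_polygon V E k f"
    using fullerene assms by (auto simp: fullerene_def)
  then obtain v e where ve: "inj_on v {..<k}" "\<And>i. i < k \<Longrightarrow> e i \<in> E \<and> e i \<inter> V = {v i, v (Suc i mod k)}"
    and fr: "frontier f = (\<Union>i<k. e i)"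
    unfolding face_is_polygon_def by auto
  have k3: "k \<ge> 3"
    using k by auto
  \<comment> \<open>An edge contained in the frontier has a point off \<open>V\<close>, and such a
    point lies on one edge only, hence on some \<open>e i\<close> equal to it.\<close>
  have eq: "face_edges E f = e ` {..<k}"
  proof
    show "e ` {..<k} \<subseteq> face_edges E f"
      using ve fr by (auto simp: face_edges_def)
    show "face_edges E f \<subseteq> e ` {..<k}"
    proof
      fix d assume "d \<in> face_edges E f"
      then have d: "d \<in> E" "d \<subseteq> frontier f"
        by (auto simp: face_edges_def)
      obtain x where x: "x \<in> d" "x \<notin> V"
        using plane_graph_edge(3)[OF plane d(1)] by blast
      then obtain i where i: "i < k" "x \<in> e i"
        using d fr by auto
      then have "d = e i"
        using x plane_graphD(4)[OF plane d(1), of "e i"] ve(2) by blast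
      then show "d \<in> e ` {..<k}"
        using i by auto
    qed
  qed
  show "plane_cycle V E (face_edges E f)" "\<Union>(face_edges E f) = frontier f"
    "x \<in> V \<Longrightarrow> card {e \<in> face_edges E f. x \<in> e} \<in> {0, 2}"
    using polygon_plane_cycle[OF plane k3 ve] fr eq by auto
  show "card (face_edges E f) \<in> {5, 6}"
    using k polygon_plane_cycle(2)[OF plane k3 ve] by (auto simp: eq card_image)
qed

text \<open>The frontier is a union of whole edges, and two distinct edges share no point off
  \<open>V\<close>.\<close>

lemma frontier_meets_edge:
  assumes "f \<in> faces V E" "e \<in> E" "(e - V) \<inter> frontier f \<noteq> {}"
  shows "e \<in> face_edges E f"
proof -
  obtain x d where "x \<in> e" "x \<notin> V" "x \<in> d" "d \<in> face_edges E f"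
    using assms face_boundary(2) by blast
  moreover from this have "d = e"
    using plane_graphD(4)[OF plane, of d e] assms(2) by (auto simp: face_edges_def)
  ultimately show ?thesis
    by simp
qed

text \<open>Existence: \<open>S\<close> accumulates at an inner point \<open>x\<close> of
  \<open>e\<close>, and near \<open>x\<close> the graph is only \<open>e\<close>, so a nearby point
  of \<open>S\<close> lies in a face, which then has \<open>e\<close> on its boundary. Uniqueness:
  points of two such faces near \<open>x\<close> are joined within \<open>S\<close>, avoiding the
  cycle, and within a ball, avoiding the rest of the graph. Janiszewski's theorem joins them off the
  whole graph.\<close>

lemma side_face_unique:
  assumes Q: "plane_cycle V E Q" "e \<in> Q" and S: "S \<in> {inside (\<Union>Q), outside (\<Union>Q)}"
  shows "\<exists>!f. f \<in> faces V E \<and> e \<in> face_edges E f \<and> f \<subseteq> S"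
proof -
  have QE: "Q \<subseteq> E" and e: "e \<in> E"
    using Q by (auto simp: plane_cycle_def)
  have S': "open S" "connected S" "frontier S = \<Union>Q"
    using plane_cycle_Jordan(3)[OF plane Q(1) S] by simp_all
  have SQ: "S \<subseteq> - \<Union>Q"
    using plane_cycle_Jordan(1)[OF plane Q(1)] S by blast
  obtain x where x: "x \<in> e - V"
    using plane_graph_edge(3)[OF plane e] by blast
  obtain r where r: "r > 0" "ball x r \<inter> (V \<union> \<Union>(E - {e})) = {}"
    using edge_point_ball[OF plane e x] .
  have face_in_S: "f \<subseteq> S" if "f \<in> faces V E" "a \<in> f" "a \<in> S" for f a
    using face_side_of_cycle[OF plane Q(1) that(1)] plane_cycle_Jordan(2)[OF plane Q(1)] S that by blast
  show ?thesis
  proof (rule ex_ex1I)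
    have "x \<in> closure S"
      using S'(3) Q(2) x by (auto simp: frontier_def)
    then obtain a where a: "a \<in> S" "a \<in> ball x r"
      using r(1) closure_approachable by (metis dist_commute mem_ball)
    then have "a \<notin> V \<union> \<Union>E"
      using r(2) SQ Q(2) by blast
    then obtain f where f: "f \<in> faces V E" "a \<in> f"
      using face_through_point by blast
    moreover have "e \<in> face_edges E f"
      using face_meets_edge_ball[OF plane e x r(2) f(1)] f a frontier_meets_edge[OF f(1) e] by blast
    ultimately show "\<exists>f. f \<in> faces V E \<and> e \<in> face_edges E f \<and> f \<subseteq> S"
      using face_in_S a by blast
  next
    fix f g
    assume f: "f \<in> faces V E \<and> e \<in> face_edges E f \<and> f \<subseteq> S"
      and g: "g \<in> faces V E \<and> e \<in> face_edges E g \<and> g \<subseteq> S"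
    have "x \<in> closure h" if "e \<in> face_edges E h" for h
      using that x by (auto simp: face_edges_def frontier_def)
    then obtain a b where ab: "a \<in> f" "a \<in> ball x r" "b \<in> g" "b \<in> ball x r"
      using f g r(1) closure_approachable by (metis dist_commute mem_ball)
    let ?T = "V \<union> \<Union>(E - {e})"
    obtain p where p: "arc p" "path_image p = \<Union>(Q - {e})" "{pathstart p, pathfinish p} = e \<inter> V"
      using Q unfolding plane_cycle_def by blast
    have "connected_component (- (\<Union>Q \<union> ?T)) a b"
    proof (rule Janiszewski)
      show "compact (\<Union>Q)" "closed ?T"
        using plane_graph_closed[OF plane] QE compact_imp_closed by blast+
      \<comment> \<open>The cycle meets the rest of the graph exactly in the arc \<open>p\<close>
        left after removing \<open>e\<close>, because \<open>e\<close> contributes only its ends,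
        which lie on \<open>p\<close>.\<close>
      have "e \<inter> ?T \<subseteq> e \<inter> V"
        using plane_graphD(4)[OF plane e] by blast
      also have "e \<inter> V \<subseteq> path_image p"
        unfolding p(3)[symmetric]
        by (simp add: pathstart_in_path_image pathfinish_in_path_image)
      finally have "\<Union>Q \<inter> ?T \<subseteq> path_image p"
        using p(2) by auto
      moreover have "path_image p \<subseteq> \<Union>Q \<inter> ?T"
        unfolding p(2) using QE by auto
      ultimately have "\<Union>Q \<inter> ?T = path_image p"
        by simp
      then show "connected (\<Union>Q \<inter> ?T)"
        using p(1) connected_arc_image by simp
      show "connected_component (- \<Union>Q) a b"
        unfolding connected_component_def using S'(2) SQ f g ab by blast
      show "connected_component (- ?T) a b"
        unfolding connected_component_def using r(2) ab by (intro exI[of _ "ball x r"]) auto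
    qed
    moreover have "\<Union>Q \<union> ?T = V \<union> \<Union>E"
      using QE Q(2) by blast
    ultimately have "b \<in> connected_component_set (- (V \<union> \<Union>E)) a"
      by simp
    moreover have "connected_component_set (- (V \<union> \<Union>E)) a \<in> faces V E"
      using faces_properties(2)[OF plane, of f] f ab unfolding faces_def by (intro componentsI) blast
    moreover have "a \<in> connected_component_set (- (V \<union> \<Union>E)) a"
      using faces_properties(2)[OF plane, of f] f ab by (simp add: connected_component_refl_eq) blast
    ultimately show "f = g"
      using f g ab components_eq unfolding faces_def by (metis disjoint_iff)
  qed
qed

text \<open>An inner point of \<open>e\<close> lies in one of the two open sides. Every face with
  this point in its closure meets that side and so is contained in it.\<close>

lemma sides_off_cycle:
  assumes Q: "plane_cycle V E Q" and e: "e \<in> E" "e \<notin> Q"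
    and f: "f \<in> faces V E" "e \<in> face_edges E f" and g: "g \<in> faces V E" "e \<in> face_edges E g"
  shows "f \<subseteq> inside (\<Union>Q) \<longleftrightarrow> g \<subseteq> inside (\<Union>Q)"
proof -
  obtain x where x: "x \<in> e - V"
    using plane_graph_edge(3)[OF plane e(1)] by blast
  have "x \<notin> \<Union>Q"
    using x e Q plane_graphD(4)[OF plane e(1)] unfolding plane_cycle_def by blast
  then have "x \<in> inside (\<Union>Q) \<union> outside (\<Union>Q)"
    using plane_cycle_Jordan(1)[OF plane Q] by simp
  then obtain S where S: "S \<in> {inside (\<Union>Q), outside (\<Union>Q)}" "x \<in> S"
    by blast
  have "open S"
    using plane_cycle_Jordan(3)[OF plane Q S(1)] by simp
  have "h \<subseteq> S" if h: "h \<in> faces V E" "e \<in> face_edges E h" for h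
  proof -
    have "x \<in> closure h"
      using h x by (auto simp: face_edges_def frontier_def)
    then have "h \<inter> S \<noteq> {}"
      using \<open>open S\<close> S(2) by (metis Int_commute disjoint_iff open_Int_closure_eq_empty)
    then show ?thesis
      using face_side_of_cycle[OF plane Q h(1)] plane_cycle_Jordan(2)[OF plane Q] S by blast
  qed
  then have "f \<subseteq> S" "g \<subseteq> S"
    using f g by auto
  moreover have "f \<noteq> {}" "g \<noteq> {}"
    using faces_properties(3)[OF plane] f g by auto
  ultimately show ?thesis
    using S(1) plane_cycle_Jordan(2)[OF plane Q] by (metis Int_greatest insertE singletonD subset_empty)
qed

text \<open>As \<open>e\<close> has empty interior, some face \<open>f\<close> comes close to an
  inner point of \<open>e\<close> and has \<open>e\<close> on its boundary. The boundary of
  \<open>f\<close> is then a cycle through \<open>e\<close>, with exactly one face at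
  \<open>e\<close> inside and one outside.\<close>

lemma edge_two_faces:
  assumes e: "e \<in> E"
  shows "card {f \<in> faces V E. e \<in> face_edges E f} = 2"
proof -
  obtain x where x: "x \<in> e - V"
    using plane_graph_edge(3)[OF plane e] by blast
  obtain r where r: "r > 0" "ball x r \<inter> (V \<union> \<Union>(E - {e})) = {}"
    using edge_point_ball[OF plane e x] .
  have "\<not> ball x r \<subseteq> e"
    using plane_graph_edge(4)[OF plane e] r(1) by (metis centre_in_ball empty_iff mem_interior)
  then obtain a where a: "a \<in> ball x r" "a \<notin> V \<union> \<Union>E"
    using r(2) by blast
  then obtain f where f: "f \<in> faces V E" "a \<in> f"
    using face_through_point by blast
  let ?Q = "face_edges E f"
  have "e \<in> ?Q"
    using face_meets_edge_ball[OF plane e x r(2) f(1)] f a frontier_meets_edge[OF f(1) e] by blast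
  note u = side_face_unique[OF face_boundary(1)[OF f(1)] this]
  obtain g where g: "\<And>h. h \<in> faces V E \<and> e \<in> face_edges E h \<and> h \<subseteq> inside (\<Union>?Q) \<longleftrightarrow> h = g"
    using u[of "inside (\<Union>?Q)"] by (auto simp: Ex1_def)
  obtain g' where g': "\<And>h. h \<in> faces V E \<and> e \<in> face_edges E h \<and> h \<subseteq> outside (\<Union>?Q) \<longleftrightarrow> h = g'"
    using u[of "outside (\<Union>?Q)"] by (auto simp: Ex1_def)
  have "{h \<in> faces V E. e \<in> face_edges E h} = {g, g'}"
    using g g' face_side_of_cycle[OF plane face_boundary(1)[OF f(1)]] by blast
  moreover have "g \<noteq> g'"
  proof
    assume "g = g'"
    then have "g \<subseteq> inside (\<Union>?Q) \<inter> outside (\<Union>?Q)" "g \<in> faces V E"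
      using g[of g] g'[of g'] by (blast, blast)
    then show False
      using plane_cycle_Jordan(2)[OF plane face_boundary(1)[OF f(1)]] faces_properties(3)[OF plane] by blast
  qed
  ultimately show ?thesis
    by simp
qed

text \<open>Shows that \<open>Q\<close> is the cut of the faces inside it: an edge of
  \<open>Q\<close> separates inside from outside, any other edge has both its faces on the same
  side.\<close>

lemma cycle_bounds:
  assumes Q: "plane_cycle V E Q"
  defines "A \<equiv> {f \<in> faces V E. f \<subseteq> inside (\<Union>Q)}"
  shows "e \<in> Q \<Longrightarrow> card {f \<in> A. e \<in> face_edges E f} = 1"
    and "e \<in> E - Q \<Longrightarrow> card {f \<in> A. e \<in> face_edges E f} \<in> {0, 2}"
proof -
  show "card {f \<in> A. e \<in> face_edges E f} = 1" if eQ: "e \<in> Q"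
  proof -
    obtain g where "\<And>h. h \<in> faces V E \<and> e \<in> face_edges E h \<and> h \<subseteq> inside (\<Union>Q) \<longleftrightarrow> h = g"
      using side_face_unique[OF Q eQ, of "inside (\<Union>Q)"] by (auto simp: Ex1_def)
    then have "{f \<in> A. e \<in> face_edges E f} = {g}"
      by (auto simp: A_def)
    then show ?thesis by simp
  qed
  show "card {f \<in> A. e \<in> face_edges E f} \<in> {0, 2}" if "e \<in> E - Q"
  proof (cases "{f \<in> A. e \<in> face_edges E f} = {}")
    case False
    then have "{f \<in> A. e \<in> face_edges E f} = {f \<in> faces V E. e \<in> face_edges E f}"
      using sides_off_cycle[OF Q] that unfolding A_def by blast
    then show ?thesis
      using edge_two_faces that by simp
  qed (metis card.empty insertI1)
qed

lemma finite_faces: "finite (faces V E)"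
proof -
  have "faces V E \<subseteq> (\<Union>e\<in>E. {f \<in> faces V E. e \<in> face_edges E f})"
  proof
    fix f assume f: "f \<in> faces V E"
    then obtain e where "e \<in> face_edges E f" "e \<in> E"
      using face_boundary(1) unfolding plane_cycle_def by blast
    then show "f \<in> (\<Union>e\<in>E. {f \<in> faces V E. e \<in> face_edges E f})"
      using f by blast
  qed
  \<comment> \<open>An infinite set has \<open>card\<close> 0, so cardinality 2 includes
    finiteness.\<close>
  moreover have "finite {f \<in> faces V E. e \<in> face_edges E f}" if "e \<in> E" for e
    using edge_two_faces[OF that] by (metis card.infinite zero_neq_numeral)
  ultimately show ?thesis
    using plane_graphD(2)[OF plane] by (meson finite_UN_I finite_subset)
qed

end

section \<open>Counting on a cubic map\<close>

lemma even_card_sym_diff: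
  assumes "finite X" "finite Y"
  shows "even (card (sym_diff X Y)) \<longleftrightarrow> (even (card X) \<longleftrightarrow> even (card Y))"
proof -
  have "card (sym_diff X Y) = card (X - Y) + card (Y - X)"
    using assms by (intro card_Un_disjoint) auto
  moreover have "card X = card (X - Y) + card (X \<inter> Y)" "card Y = card (Y - X) + card (X \<inter> Y)"
    using assms by (metis add.commute card_Int_Diff inf_commute)+
  ultimately show ?thesis
    by presburger
qed

lemma sum_card_filter_swap:
  fixes A :: "'c set" and B :: "'d set"
  assumes "finite A" "finite B"
  shows "(\<Sum>a\<in>A. card {b \<in> B. R a b}) = (\<Sum>b\<in>B. card {a \<in> A. R a b})"
proof -
  have card: "finite X \<Longrightarrow> card {x \<in> X. P x} = (\<Sum>x\<in>X. if P x then 1 else 0)" for X :: "'c set" and P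
    by (simp add: sum.If_cases Int_def)
  have card': "finite X \<Longrightarrow> card {x \<in> X. P x} = (\<Sum>x\<in>X. if P x then 1 else 0)" for X :: "'d set" and P
    by (simp add: sum.If_cases Int_def)
  show ?thesis
    unfolding card[OF assms(1)] card'[OF assms(2)] by (rule sum.swap)
qed

text \<open>Take a longest path. Its last vertex \<open>w\<close> has a second edge, whose other end
  \<open>y\<close> is on the path by maximality and is not the penultimate vertex because
  \<open>ends\<close> is injective. The segment from \<open>y\<close> to \<open>w\<close> closes up
  to a polygon with at least three vertices.\<close>

lemma exists_polygon:
  fixes ends :: "'e \<Rightarrow> 'v set"
  assumes fin: "finite V" "finite D" and "D \<noteq> {}" and inj: "inj_on ends D"
    and ends: "\<And>e. e \<in> D \<Longrightarrow> ends e \<subseteq> V \<and> card (ends e) = 2"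
    and deg: "\<And>v. v \<in> V \<Longrightarrow> card {e \<in> D. v \<in> ends e} \<noteq> 1"
  obtains k v e where "k \<ge> 3" "inj_on v {..<k}"
    and "\<And>i. i < k \<Longrightarrow> e i \<in> D \<and> ends (e i) = {v i, v (Suc i mod k)}"
proof -
  define path where "path xs \<longleftrightarrow> distinct xs \<and> set xs \<subseteq> V \<and> length xs \<ge> 2 \<and>
      (\<forall>i. Suc i < length xs \<longrightarrow> (\<exists>e\<in>D. ends e = {xs ! i, xs ! Suc i}))" for xs
  obtain e0 where "e0 \<in> D"
    using \<open>D \<noteq> {}\<close> by blast
  moreover obtain a b where ab: "ends e0 = {a, b}" "a \<noteq> b"
    using ends[OF \<open>e0 \<in> D\<close>] by (meson card_2_iff)
  ultimately have "path [a, b]"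
    using ends[of e0] by (auto simp: path_def less_Suc_eq intro!: bexI[of _ e0])
  moreover have "length xs < Suc (card V)" if "path xs" for xs
    using that fin(1) by (metis path_def card_mono distinct_card le_imp_less_Suc)
  ultimately obtain xs where xs: "path xs" "\<And>ys. path ys \<Longrightarrow> length ys \<le> length xs"
    using ex_has_greatest_nat[of path "[a, b]" length "Suc (card V)"] by (metis less_imp_le)
  define n where "n = length xs"
  have n: "n \<ge> 2" and dist: "distinct xs" and xsV: "set xs \<subseteq> V"
    using xs(1) by (auto simp: path_def n_def)
  define w u where "w = xs ! (n - 1)" and "u = xs ! (n - 2)"
  have "Suc (n - 2) = n - 1"
    using n by simp
  moreover have "Suc (n - 2) < n"
    using n by simp
  ultimately obtain d where d: "d \<in> D" "ends d = {u, w}"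
    using xs(1) unfolding path_def w_def u_def n_def by metis
  have wV: "w \<in> V"
    using xsV n by (auto simp: w_def n_def)
  have "{e \<in> D. w \<in> ends e} \<noteq> {d}"
    using deg[OF wV] by fastforce
  then obtain d' where d': "d' \<in> D" "w \<in> ends d'" "d' \<noteq> d"
    using d by blast
  then obtain y where y: "ends d' = {w, y}" "y \<noteq> w"
    using ends[OF d'(1)] by (metis card_2_iff doubleton_eq_iff insertE singletonD)
  have "y \<noteq> u"
    using y d d' inj by (metis inj_on_eq_iff insert_commute)
  have "y \<in> set xs"
  proof (rule ccontr)
    assume "y \<notin> set xs"
    have "\<exists>e\<in>D. ends e = {(xs @ [y]) ! i, (xs @ [y]) ! Suc i}" if "Suc i < length (xs @ [y])" for i
    proof (cases "Suc i < n")
      case True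
      then show ?thesis
        using xs(1) by (auto simp: path_def nth_append n_def)
    next
      case False
      then have "i = n - 1"
        using that by (auto simp: n_def)
      then show ?thesis
        using d' y n by (intro bexI[of _ d']) (auto simp: nth_append n_def w_def)
    qed
    then have "path (xs @ [y])"
      using xs(1) \<open>y \<notin> set xs\<close> y d' ends[of d'] by (auto simp: path_def)
    then show False
      using xs(2) by fastforce
  qed
  then obtain j where j: "j < n" "xs ! j = y"
    by (auto simp: in_set_conv_nth n_def)
  have "j \<noteq> n - 1" "j \<noteq> n - 2"
    using j y \<open>y \<noteq> u\<close> by (auto simp: w_def u_def)
  then have j2: "j + 3 \<le> n"
    using j n by simp
  define k where "k = n - j"
  have k: "k \<ge> 3" "j + k = n"
    using j2 by (auto simp: k_def)
  define v where "v i = xs ! (j + i)" for i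
  have "\<exists>e\<in>D. ends e = {v i, v (Suc i mod k)}" if "i < k" for i
  proof (cases "Suc i = k")
    case True
    then have "j + i = n - 1"
      using k by simp
    then show ?thesis
      using d' y j True by (intro bexI[of _ d']) (auto simp: v_def w_def)
  next
    case False
    then have "Suc i < k" "Suc (j + i) < n"
      using that k by auto
    then show ?thesis
      using xs(1) by (auto simp: path_def v_def n_def)
  qed
  then obtain e where "\<And>i. i < k \<Longrightarrow> e i \<in> D \<and> ends (e i) = {v i, v (Suc i mod k)}"
    by metis
  moreover have "inj_on v {..<k}"
    using dist k by (auto simp: inj_on_def v_def nth_eq_iff_index_eq n_def)
  ultimately show ?thesis
    using that k(1) by blast
qed

text \<open>
  The last assumption is the only trace of planarity: every even subgraph is the cut between a
  set of faces and its complement.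
\<close>

locale fullerene_map =
  fixes V :: "'v set" and E :: "'e set" and F :: "'f set"
    and ends :: "'e \<Rightarrow> 'v set" and bd :: "'f \<Rightarrow> 'e set"
  assumes finite: "finite V" "finite E" "finite F" and V_nonempty: "V \<noteq> {}"
    and ends: "e \<in> E \<Longrightarrow> ends e \<subseteq> V" "e \<in> E \<Longrightarrow> card (ends e) = 2"
    and cubic: "v \<in> V \<Longrightarrow> card {e \<in> E. v \<in> ends e} = 3"
    and bd: "f \<in> F \<Longrightarrow> bd f \<subseteq> E" "f \<in> F \<Longrightarrow> card (bd f) \<in> {5, 6}"
    and bd_vertex: "f \<in> F \<Longrightarrow> v \<in> V \<Longrightarrow> card {e \<in> bd f. v \<in> ends e} \<in> {0, 2}"
    and two_faces: "e \<in> E \<Longrightarrow> card {f \<in> F. e \<in> bd f} = 2"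
    and cut: "C \<subseteq> E \<Longrightarrow> (\<And>v. v \<in> V \<Longrightarrow> even (card {e \<in> C. v \<in> ends e})) \<Longrightarrow>
        \<exists>A\<subseteq>F. \<forall>e\<in>E. e \<in> C \<longleftrightarrow> odd (card {f \<in> A. e \<in> bd f})"
begin

section \<open>Degrees, Euler characteristic and local structure at a vertex\<close>

definition deg :: "'e set \<Rightarrow> 'v \<Rightarrow> nat" where
  "deg D v = card {e \<in> D. v \<in> ends e}"

definition vs :: "'f \<Rightarrow> 'v set" where
  "vs f = {v \<in> V. \<exists>e\<in>bd f. v \<in> ends e}"

lemma finite_sub: "D \<subseteq> E \<Longrightarrow> finite D"
  using finite(2) finite_subset by blast

lemma finite_bd: "f \<in> F \<Longrightarrow> finite (bd f)"
  using bd(1) finite_sub by blast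

lemma finite_vs: "finite (vs f)"
  using finite(1) by (simp add: vs_def)

lemma deg_nonzero: "deg D v \<noteq> 0 \<Longrightarrow> \<exists>e\<in>D. v \<in> ends e"
  unfolding deg_def by (metis (no_types, lifting) Collect_empty_eq card.empty)

lemma handshake:
  assumes "D \<subseteq> E"
  shows "(\<Sum>v\<in>V. deg D v) = 2 * card D"
proof -
  have "(\<Sum>v\<in>V. deg D v) = (\<Sum>e\<in>D. card {v \<in> V. v \<in> ends e})"
    unfolding deg_def using finite finite_sub[OF assms] by (intro sum_card_filter_swap)
  also have "\<dots> = (\<Sum>e\<in>D. 2)"
  proof (rule sum.cong)
    fix e assume "e \<in> D"
    then have "{v \<in> V. v \<in> ends e} = ends e" "card (ends e) = 2"
      using assms ends by blast+
    then show "card {v \<in> V. v \<in> ends e} = 2" by simp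
  qed simp
  finally show ?thesis by simp
qed

lemma deg_mono: "D \<subseteq> D' \<Longrightarrow> D' \<subseteq> E \<Longrightarrow> deg D v \<le> deg D' v"
  unfolding deg_def using finite_sub by (intro card_mono) auto

lemma deg_bd: "f \<in> F \<Longrightarrow> v \<in> V \<Longrightarrow> deg (bd f) v = (if v \<in> vs f then 2 else 0)"
proof -
  assume f: "f \<in> F" "v \<in> V"
  have "deg (bd f) v = 0 \<longleftrightarrow> v \<notin> vs f"
    using finite_bd[OF f(1)] f(2) by (auto simp: deg_def vs_def)
  then show ?thesis
    using bd_vertex[OF f] by (auto simp: deg_def)
qed

text \<open>Handshake on \<open>bd f\<close>, whose degree is 2 at the vertices of \<open>f\<close>
  and 0 elsewhere.\<close>

lemma card_vs:
  assumes "f \<in> F"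
  shows "card (vs f) = card (bd f)"
proof -
  have "2 * card (bd f) = (\<Sum>v\<in>V. deg (bd f) v)"
    using handshake[OF bd(1)[OF assms]] by simp
  also have "\<dots> = (\<Sum>v\<in>V. if v \<in> vs f then 2 else 0)"
    using deg_bd[OF assms] by simp
  also have "\<dots> = 2 * card (vs f)"
    using finite by (simp add: sum.If_cases vs_def Int_def)
  finally show ?thesis by simp
qed

lemma cubic_edges: "3 * card V = 2 * card E"
  using handshake[OF subset_refl] cubic by (simp add: deg_def)

lemma sum_card_bd: "(\<Sum>f\<in>F. card (bd f)) = 2 * card E"
proof -
  have "(\<Sum>f\<in>F. card (bd f)) = (\<Sum>f\<in>F. card {e \<in> E. e \<in> bd f})"
    using bd(1) by (intro sum.cong refl arg_cong[of _ _ card]) blast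
  also have "\<dots> = (\<Sum>e\<in>E. card {f \<in> F. e \<in> bd f})"
    using finite by (intro sum_card_filter_swap)
  finally show ?thesis
    using two_faces by simp
qed

lemma even_deg_sym_diff:
  assumes "C \<subseteq> E" "D \<subseteq> E"
  shows "even (deg (sym_diff C D) v) \<longleftrightarrow> (even (deg C v) \<longleftrightarrow> even (deg D v))"
proof -
  have "{e \<in> sym_diff C D. v \<in> ends e} = sym_diff {e \<in> C. v \<in> ends e} {e \<in> D. v \<in> ends e}"
    by blast
  then show ?thesis
    unfolding deg_def using assms finite_sub by (simp add: even_card_sym_diff del: Un_iff Diff_iff)
qed

text \<open>
  There are at most \<open>2 ^ (|F| - 1)\<close> even subgraphs because complementary sets of faces have the
  same cut, and at least \<open>2 ^ (|E| - |V| + 1)\<close> because the parities of the degrees satisfy one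
  linear relation.
\<close>

lemma euler: "card E + 2 \<le> card V + card F"
proof -
  define Ev where "Ev = {C \<in> Pow E. \<forall>v\<in>V. even (deg C v)}"
  have finEv: "finite Ev"
    using finite by (simp add: Ev_def)
  obtain v0 where v0: "v0 \<in> V"
    using V_nonempty by blast
  then obtain e0 where "e0 \<in> E"
    using cubic[OF v0] by (metis (no_types, lifting) card.empty empty_Collect_eq zero_neq_numeral)
  then obtain f0 where f0: "f0 \<in> F"
    using two_faces[of e0] by (metis (no_types, lifting) card.empty empty_Collect_eq zero_neq_numeral)
  \<comment> \<open>Of a face set and its complement one avoids \<open>f0\<close>, so only subsets
    of \<open>F - {f0}\<close> are needed as representatives.\<close>
  have "Ev \<subseteq> (\<lambda>B. {e \<in> E. odd (card {f \<in> B. e \<in> bd f})}) ` Pow (F - {f0})"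
  proof
    fix C assume "C \<in> Ev"
    then obtain A where A: "A \<subseteq> F" "\<And>e. e \<in> E \<Longrightarrow> e \<in> C \<longleftrightarrow> odd (card {f \<in> A. e \<in> bd f})"
      using cut[of C] by (auto simp: Ev_def deg_def)
    have compl: "odd (card {f \<in> F - A. e \<in> bd f}) \<longleftrightarrow> odd (card {f \<in> A. e \<in> bd f})" if "e \<in> E" for e
    proof -
      have "card {f \<in> F. e \<in> bd f} = card ({f \<in> F - A. e \<in> bd f} \<union> {f \<in> A. e \<in> bd f})"
        using A(1) by (intro arg_cong[of _ _ card]) auto
      also have "\<dots> = card {f \<in> F - A. e \<in> bd f} + card {f \<in> A. e \<in> bd f}"
        using finite finite_subset[OF A(1)] by (intro card_Un_disjoint) auto
      finally show ?thesis
        using two_faces[OF that] by presburger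
    qed
    have C: "C = {e \<in> E. odd (card {f \<in> A. e \<in> bd f})}" "C = {e \<in> E. odd (card {f \<in> F - A. e \<in> bd f})}"
      using A(2) compl \<open>C \<in> Ev\<close> by (auto simp: Ev_def)
    show "C \<in> (\<lambda>B. {e \<in> E. odd (card {f \<in> B. e \<in> bd f})}) ` Pow (F - {f0})"
    proof (cases "f0 \<in> A")
      case True
      then show ?thesis
        using C(2) by (intro image_eqI[of _ _ "F - A"]) auto
    next
      case False
      then show ?thesis
        using C(1) A(1) by (intro image_eqI[of _ _ A]) auto
    qed
  qed
  then have "card Ev \<le> card (Pow (F - {f0}))"
    using finite by (intro surj_card_le) auto
  then have Ev_le: "card Ev \<le> 2 ^ (card F - 1)"
    using f0 finite by (simp add: card_Pow)
  \<comment> \<open>The parity at \<open>v0\<close> is left out, as the handshake lemma determines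
    it from the others. So \<open>\<psi>\<close> has at most \<open>2 ^ (card V - 1)\<close>
    values.\<close>
  define \<psi> where "\<psi> C = {v \<in> V - {v0}. odd (deg C v)}" for C
  \<comment> \<open>Adding a fixed member \<open>C0\<close> modulo 2 maps the fibre injectively into
    the even subgraphs.\<close>
  have fiber: "card {C \<in> Pow E. \<psi> C = T} \<le> card Ev" if T: "T \<in> \<psi> ` Pow E" for T
  proof -
    obtain C0 where C0: "C0 \<subseteq> E" "\<psi> C0 = T"
      using T by auto
    have "(\<lambda>C. sym_diff C C0) ` {C \<in> Pow E. \<psi> C = T} \<subseteq> Ev"
    proof (rule image_subsetI)
      fix C assume C: "C \<in> {C \<in> Pow E. \<psi> C = T}"
      let ?D = "sym_diff C C0"
      have D: "?D \<subseteq> E"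
        using C C0 by auto
      have ev: "even (deg ?D v)" if "v \<in> V - {v0}" for v
      proof -
        have "odd (deg C v) \<longleftrightarrow> odd (deg C0 v)"
          using C0(2) C that unfolding \<psi>_def by blast
        then show ?thesis
          using even_deg_sym_diff[of C C0 v] C C0(1) by simp
      qed
      then have "even (\<Sum>v\<in>V - {v0}. deg ?D v)"
        by (intro dvd_sum) auto
      moreover have "(\<Sum>v\<in>V. deg ?D v) = deg ?D v0 + (\<Sum>v\<in>V - {v0}. deg ?D v)"
        using finite v0 by (intro sum.remove)
      ultimately have "even (deg ?D v0)"
        using handshake[OF D] by (metis dvd_add_left_iff dvd_triv_left)
      then show "?D \<in> Ev"
        using ev D by (auto simp: Ev_def)
    qed
    moreover have "inj_on (\<lambda>C. sym_diff C C0) {C \<in> Pow E. \<psi> C = T}"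
      by (rule inj_onI) blast
    ultimately show ?thesis
      using finEv card_inj_on_le by blast
  qed
  have "\<psi> ` Pow E \<subseteq> Pow (V - {v0})"
    by (auto simp: \<psi>_def)
  then have im: "card (\<psi> ` Pow E) \<le> 2 ^ (card V - 1)"
    using finite v0 card_mono[of "Pow (V - {v0})"] by (simp add: card_Pow)
  have "2 ^ card E = card (Pow E)"
    using finite by (simp add: card_Pow)
  also have "Pow E = (\<Union>T\<in>\<psi> ` Pow E. {C \<in> Pow E. \<psi> C = T})"
    by blast
  also have "card \<dots> \<le> (\<Sum>T\<in>\<psi> ` Pow E. card {C \<in> Pow E. \<psi> C = T})"
    using finite by (intro card_UN_le) auto
  also have "\<dots> \<le> card (\<psi> ` Pow E) * card Ev"
    using sum_bounded_above[of "\<psi> ` Pow E" "\<lambda>T. card {C \<in> Pow E. \<psi> C = T}" "card Ev"] fiber by simp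
  also have "\<dots> \<le> 2 ^ (card V - 1) * 2 ^ (card F - 1)"
    using im Ev_le by (intro mult_mono) auto
  finally have "(2::nat) ^ card E \<le> 2 ^ (card V - 1 + (card F - 1))"
    by (simp add: power_add)
  then have "card E \<le> card V - 1 + (card F - 1)"
    by simp
  moreover have "card V > 0" "card F > 0"
    using v0 f0 finite by (auto simp: card_gt_0_iff)
  ultimately show ?thesis
    by linarith
qed

definition pentagons :: "'f set" where
  "pentagons = {f \<in> F. card (bd f) = 5}"

text \<open>Here \<open>c\<close> is the Euler characteristic, at least 2 by \<open>euler\<close>.
  Face lengths sum to \<open>2 * card E\<close>, and \<open>3 * card V = 2 * card E\<close>, which
  gives \<open>6 * c\<close> pentagons. As there are at most \<open>card F\<close> of them,
  \<open>6 * c \<le> c + card V / 2\<close>, which is the last bound.\<close>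

lemma card_pentagons:
  obtains c where "c \<ge> 2" "card pentagons = 6 * c" "10 * c \<le> card V"
proof -
  have "(\<Sum>f\<in>F. card (bd f)) + card pentagons = (\<Sum>f\<in>F. card (bd f) + (if card (bd f) = 5 then 1 else 0))"
    using finite by (simp add: sum.distrib sum.If_cases pentagons_def Int_def)
  also have "\<dots> = (\<Sum>f\<in>F. 6)"
    using bd(2) by (intro sum.cong) auto
  finally have p: "2 * card E + card pentagons = 6 * card F"
    by (simp add: sum_card_bd)
  have "card pentagons \<le> card F"
    using finite by (auto simp: pentagons_def intro: card_mono)
  then show ?thesis
    using that[of "card F + card V - card E"] p euler cubic_edges by linarith
qed

text \<open>Count pairs of a face and an edge of it at \<open>v\<close>: each face at
  \<open>v\<close> has two edges there, and each of the three edges has two faces.\<close>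

lemma card_faces_at:
  assumes v: "v \<in> V"
  shows "card {f \<in> F. v \<in> vs f} = 3"
proof -
  have "2 * card {f \<in> F. v \<in> vs f} = (\<Sum>f\<in>F. deg (bd f) v)"
    using finite deg_bd[OF _ v] by (simp add: sum.If_cases Int_def)
  also have "\<dots> = (\<Sum>f\<in>F. card {e \<in> {e \<in> E. v \<in> ends e}. e \<in> bd f})"
    unfolding deg_def using bd(1) by (intro sum.cong refl arg_cong[of _ _ card]) auto
  also have "\<dots> = (\<Sum>e\<in>{e \<in> E. v \<in> ends e}. card {f \<in> F. e \<in> bd f})"
    using finite by (intro sum_card_filter_swap) auto
  also have "\<dots> = 6"
    using two_faces cubic[OF v] by simp
  finally show ?thesis by simp
qed

text \<open>Of the three faces at \<open>v\<close>, two contain \<open>e\<close>. The third is the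
  face opposite to \<open>e\<close>, to which a vertex of \<open>U\<close> with matching edge
  \<open>e\<close> will be charged.\<close>

lemma card_faces_opposite:
  assumes e: "e \<in> E" "v \<in> ends e"
  shows "card {f \<in> F. v \<in> vs f \<and> e \<notin> bd f} = 1"
proof -
  have v: "v \<in> V"
    using e ends(1) by auto
  have "{f \<in> F. v \<in> vs f \<and> e \<notin> bd f} = {f \<in> F. v \<in> vs f} - {f \<in> F. e \<in> bd f}"
    by blast
  moreover have "{f \<in> F. e \<in> bd f} \<subseteq> {f \<in> F. v \<in> vs f}"
    using e v by (auto simp: vs_def)
  ultimately show ?thesis
    using card_faces_at[OF v] two_faces[OF e(1)] finite by (simp add: card_Diff_subset)
qed

text \<open>Both faces miss the third edge at \<open>v\<close>, and only one face at
  \<open>v\<close> does so.\<close>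

lemma face_corner_unique:
  assumes f: "f \<in> F" "v \<in> vs f" and g: "g \<in> F" "v \<in> vs g"
    and eq: "{e \<in> bd f. v \<in> ends e} = {e \<in> bd g. v \<in> ends e}"
  shows "f = g"
proof -
  have v: "v \<in> V"
    using f by (simp add: vs_def)
  have "card {e \<in> bd f. v \<in> ends e} = 2"
    using deg_bd[OF f(1) v] f(2) by (simp add: deg_def)
  then have "{e \<in> E. v \<in> ends e} \<noteq> {e \<in> bd f. v \<in> ends e}"
    using cubic[OF v] by force
  then obtain e where e: "e \<in> E" "v \<in> ends e" "e \<notin> bd f"
    using bd(1)[OF f(1)] by blast
  then have "e \<notin> bd g"
    using eq by blast
  then have "{f, g} \<subseteq> {f \<in> F. v \<in> vs f \<and> e \<notin> bd f}"
    using f g e by blast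
  moreover obtain h where "{f \<in> F. v \<in> vs f \<and> e \<notin> bd f} = {h}"
    using card_faces_opposite[OF e(1,2)] by (metis card_1_singletonE)
  ultimately have "{f, g} \<subseteq> {h}"
    by simp
  then show ?thesis
    by simp
qed

end

section \<open>Defects of the faces off a resonant pattern\<close>

locale resonant_map = fullerene_map +
  fixes P :: "'c set" and M :: "'b set"
  assumes P: "P \<subseteq> F" and M: "M \<subseteq> E"
    and matching: "v \<in> V \<Longrightarrow> \<exists>!e. e \<in> M \<and> v \<in> ends e"
    and alternating: "f \<in> P \<Longrightarrow> 2 * card (bd f \<inter> M) = card (bd f)"
    and disjoint: "f \<in> P \<Longrightarrow> g \<in> P \<Longrightarrow> f \<noteq> g \<Longrightarrow> vs f \<inter> vs g = {}"
begin

definition EP :: "'b set" where "EP = (\<Union>f\<in>P. bd f)"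
definition U :: "'a set" where "U = V - (\<Union>f\<in>P. vs f)"
definition Z :: "'b set" where "Z = EP \<union> M"

lemma finite_P: "finite P"
  using P finite finite_subset by blast

lemma EP: "EP \<subseteq> E"
  using P bd(1) by (auto simp: EP_def)

lemma Z: "Z \<subseteq> E"
  using EP M by (simp add: Z_def)

lemma deg_M: "v \<in> V \<Longrightarrow> deg M v = 1"
proof -
  assume "v \<in> V"
  then obtain e where "{e \<in> M. v \<in> ends e} = {e}"
    using matching by blast
  then show ?thesis
    by (simp add: deg_def)
qed

lemma pattern_face_hexagon:
  assumes "f \<in> P"
  shows "card (bd f) = 6"
proof -
  have "card (bd f) \<in> {5, 6}"
    using assms P bd(2) by blast
  moreover have "even (card (bd f))"
    using alternating[OF assms] by presburger
  ultimately show ?thesis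
    by auto
qed

text \<open>The three matching edges of an alternating hexagon cover its six vertices.\<close>

lemma pattern_face_matched:
  assumes f: "f \<in> P" and v: "v \<in> vs f" and e: "e \<in> M" "v \<in> ends e"
  shows "e \<in> bd f"
proof -
  have fF: "f \<in> F"
    using P f by blast
  have sub: "bd f \<inter> M \<subseteq> E" "bd f \<inter> M \<subseteq> M"
    using M by auto
  let ?W = "{v \<in> V. deg (bd f \<inter> M) v = 1}"
  have deg_le: "deg (bd f \<inter> M) v \<le> 1" if "v \<in> V" for v
    using deg_mono[OF sub(2) M] deg_M[OF that] by metis
  then have "(\<Sum>v\<in>V. deg (bd f \<inter> M) v) = (\<Sum>v\<in>V. if deg (bd f \<inter> M) v = 1 then 1 else 0)"
    by (intro sum.cong) (auto simp: le_Suc_eq)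
  then have "card ?W = 2 * card (bd f \<inter> M)"
    using finite handshake[OF sub(1)] by (simp add: sum.If_cases Int_def)
  also have "\<dots> = card (vs f)"
    using alternating[OF f] card_vs[OF fF] by simp
  finally have "card ?W = card (vs f)" .
  moreover have "?W \<subseteq> vs f"
  proof
    fix v assume "v \<in> ?W"
    then show "v \<in> vs f"
      using deg_nonzero[of "bd f \<inter> M" v] by (auto simp: vs_def)
  qed
  ultimately have "?W = vs f"
    using finite_vs card_subset_eq by blast
  then have "v \<in> ?W"
    using v by simp
  then have "deg (bd f \<inter> M) v \<noteq> 0" "v \<in> V"
    by auto
  then show ?thesis
    using e matching[of v] deg_nonzero by blast
qed

text \<open>By disjointness no other pattern face passes through \<open>v\<close>, and the matching
  edge at \<open>v\<close> already lies on \<open>bd f\<close>.\<close>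

lemma EP_at_pattern_face:
  assumes f: "f \<in> P" and v: "v \<in> vs f"
  shows "{e \<in> EP. v \<in> ends e} = {e \<in> bd f. v \<in> ends e}" "{e \<in> Z. v \<in> ends e} = {e \<in> bd f. v \<in> ends e}"
proof -
  have vV: "v \<in> V"
    using v by (simp add: vs_def)
  show *: "{e \<in> EP. v \<in> ends e} = {e \<in> bd f. v \<in> ends e}"
  proof
    show "{e \<in> EP. v \<in> ends e} \<subseteq> {e \<in> bd f. v \<in> ends e}"
    proof clarify
      fix e assume e: "e \<in> EP" "v \<in> ends e"
      then obtain g where g: "g \<in> P" "e \<in> bd g"
        by (auto simp: EP_def)
      then have "v \<in> vs g"
        using e vV by (auto simp: vs_def)
      then have "g = f"
        using disjoint[OF f g(1)] v by blast
      then show "e \<in> bd f"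
        using g by simp
    qed
  qed (use f in \<open>auto simp: EP_def\<close>)
  then show "{e \<in> Z. v \<in> ends e} = {e \<in> bd f. v \<in> ends e}"
    using pattern_face_matched[OF f v] by (auto simp: Z_def)
qed

lemma EP_at_U: "v \<in> U \<Longrightarrow> {e \<in> EP. v \<in> ends e} = {}"
  by (auto simp: U_def EP_def vs_def)

text \<open>At \<open>v\<close> the set \<open>Z\<close> consists of the two edges of
  \<open>h\<close>. The distinct faces \<open>f\<close> and \<open>h\<close> each use two of the
  three edges at \<open>v\<close>, hence share exactly one.\<close>

lemma deg_Z_face_pattern:
  assumes f: "f \<in> F - P" "v \<in> vs f" and h: "h \<in> P" "v \<in> vs h"
  shows "deg (bd f \<inter> Z) v = 1"
proof -
  let ?A = "{e \<in> bd f. v \<in> ends e}" and ?B = "{e \<in> bd h. v \<in> ends e}"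
  have hF: "h \<in> F" and fF: "f \<in> F" and v: "v \<in> V"
    using P f h by (auto simp: vs_def)
  have cards: "card ?A = 2" "card ?B = 2"
    using deg_bd[OF fF v] deg_bd[OF hF v] f h by (auto simp: deg_def)
  then have fin: "finite ?A" "finite ?B"
    using finite_bd[OF fF] finite_bd[OF hF] by auto
  have "?A \<noteq> ?B"
    using face_corner_unique[OF fF f(2) hF h(2)] f h by blast
  then have "?A \<inter> ?B \<noteq> ?A"
    using card_subset_eq[OF fin(2), of ?A] cards by auto
  then have "card (?A \<inter> ?B) < 2"
    using psubset_card_mono[OF fin(1), of "?A \<inter> ?B"] cards by auto
  moreover have "card (?A \<union> ?B) \<le> 3"
    unfolding cubic[OF v, symmetric] using bd(1)[OF fF] bd(1)[OF hF] finite by (intro card_mono) auto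
  then have "card (?A \<inter> ?B) \<ge> 1"
    using card_Un_Int[OF fin] cards by linarith
  moreover have "{e \<in> bd f \<inter> Z. v \<in> ends e} = ?A \<inter> ?B"
    using EP_at_pattern_face(2)[OF h] by blast
  ultimately show ?thesis
    by (simp add: deg_def)
qed

text \<open>For a face off \<open>P\<close> the vertices counted are those of \<open>U\<close> on
  \<open>f\<close> whose matching edge is not on \<open>bd f\<close>; vertices on pattern faces drop
  out by \<open>deg_Z_face_pattern\<close>.\<close>

definition defect :: "'c \<Rightarrow> nat" where
  "defect f = card {v \<in> vs f. deg (bd f \<inter> Z) v = 0}"

text \<open>The \<open>Z\<close>-edges of \<open>f\<close> form a matching: at a vertex of
  \<open>U\<close> only the edge of \<open>M\<close> is in \<open>Z\<close>, and at a vertex of the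
  pattern exactly one edge of \<open>f\<close> is. So every vertex of \<open>f\<close> is covered
  once or is a defect.\<close>

lemma card_bd_defect:
  assumes f: "f \<in> F - P"
  shows "card (bd f) = 2 * card (bd f \<inter> Z) + defect f"
proof -
  have fF: "f \<in> F"
    using f by blast
  have sub: "bd f \<inter> Z \<subseteq> E"
    using Z by auto
  have le1: "deg (bd f \<inter> Z) v \<le> 1" if v: "v \<in> vs f" for v
  proof (cases "v \<in> U")
    case True
    have "deg (bd f \<inter> Z) v \<le> deg Z v"
      using Z by (intro deg_mono) auto
    also have "\<dots> = deg M v"
      using EP_at_U[OF True] unfolding deg_def Z_def by (intro arg_cong[of _ _ card]) blast
    finally show ?thesis
      using deg_M v by (simp add: vs_def)
  next
    case False
    then obtain h where "h \<in> P" "v \<in> vs h"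
      using v by (auto simp: U_def vs_def)
    then show ?thesis
      using deg_Z_face_pattern[OF f v] by simp
  qed
  have "(\<Sum>v\<in>vs f. deg (bd f \<inter> Z) v) + defect f
      = (\<Sum>v\<in>vs f. deg (bd f \<inter> Z) v + (if deg (bd f \<inter> Z) v = 0 then 1 else 0))"
    using finite_vs by (simp add: sum.distrib sum.If_cases Int_def defect_def)
  also have "\<dots> = (\<Sum>v\<in>vs f. 1)"
  proof (rule sum.cong)
    fix v assume "v \<in> vs f"
    then show "deg (bd f \<inter> Z) v + (if deg (bd f \<inter> Z) v = 0 then 1 else 0) = 1"
      using le1[of v] by auto
  qed simp
  also have "\<dots> = card (bd f)"
    using card_vs[OF fF] by simp
  also have "(\<Sum>v\<in>vs f. deg (bd f \<inter> Z) v) = (\<Sum>v\<in>V. deg (bd f \<inter> Z) v)"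
  proof (intro sum.mono_neutral_left finite)
    show "\<forall>v\<in>V - vs f. deg (bd f \<inter> Z) v = 0"
      using deg_nonzero[of "bd f \<inter> Z"] by (fastforce simp: vs_def)
  qed (auto simp: vs_def)
  also have "\<dots> = 2 * card (bd f \<inter> Z)"
    by (rule handshake[OF sub])
  finally show ?thesis by simp
qed

text \<open>Each vertex of \<open>U\<close> is a defect of just one face, the one opposite to its
  matching edge. This face is off \<open>P\<close>, as no pattern face contains the vertex.\<close>

lemma sum_defect: "(\<Sum>f\<in>F - P. defect f) = card U"
proof -
  obtain m where m: "\<And>v. v \<in> V \<Longrightarrow> m v \<in> M \<and> v \<in> ends (m v)"
    using matching by metis
  have UV: "U \<subseteq> V"
    by (auto simp: U_def)
  have "{v \<in> vs f. deg (bd f \<inter> Z) v = 0} = {v \<in> U. v \<in> vs f \<and> m v \<notin> bd f}" if f: "f \<in> F - P" for f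
  proof -
    have "deg (bd f \<inter> Z) v = 0 \<longleftrightarrow> m v \<notin> bd f" if v: "v \<in> U" for v
    proof -
      have "{e \<in> Z. v \<in> ends e} = {m v}"
        using EP_at_U[OF v] m matching v UV unfolding Z_def by blast
      then have "{e \<in> bd f \<inter> Z. v \<in> ends e} = {m v} \<inter> bd f"
        by blast
      then show ?thesis
        by (simp add: deg_def)
    qed
    moreover have "v \<in> U" if "v \<in> vs f" "deg (bd f \<inter> Z) v = 0" for v
      using deg_Z_face_pattern[OF f that(1)] that by (force simp: U_def vs_def)
    ultimately show ?thesis
      by blast
  qed
  then have "(\<Sum>f\<in>F - P. defect f) = (\<Sum>f\<in>F - P. card {v \<in> U. v \<in> vs f \<and> m v \<notin> bd f})"
    by (simp add: defect_def)
  also have "\<dots> = (\<Sum>v\<in>U. card {f \<in> F - P. v \<in> vs f \<and> m v \<notin> bd f})"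
    using finite by (intro sum_card_filter_swap) (auto simp: U_def)
  also have "\<dots> = (\<Sum>v\<in>U. 1)"
  proof (rule sum.cong)
    fix v assume v: "v \<in> U"
    then have "{f \<in> F - P. v \<in> vs f \<and> m v \<notin> bd f} = {f \<in> F. v \<in> vs f \<and> m v \<notin> bd f}"
      by (auto simp: U_def)
    moreover have "m v \<in> E" "v \<in> ends (m v)"
      using m v UV M by auto
    ultimately show "card {f \<in> F - P. v \<in> vs f \<and> m v \<notin> bd f} = 1"
      using card_faces_opposite by simp
  qed simp
  finally show ?thesis by simp
qed

lemma card_V: "card V = 6 * card P + card U"
proof -
  have "card (\<Union>f\<in>P. vs f) = (\<Sum>f\<in>P. card (vs f))"
    using finite_P finite_vs disjoint by (intro card_UN_disjoint) auto
  also have "\<dots> = (\<Sum>f\<in>P. 6)"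
    using P card_vs pattern_face_hexagon by (intro sum.cong) auto
  finally have "card (\<Union>f\<in>P. vs f) = 6 * card P"
    by simp
  moreover have "(\<Union>f\<in>P. vs f) \<subseteq> V"
    by (auto simp: vs_def)
  ultimately show ?thesis
    using finite card_mono[of V "\<Union>f\<in>P. vs f"] by (simp add: U_def card_Diff_subset finite_subset)
qed

lemma pentagons_off_pattern: "pentagons \<subseteq> F - P"
  using pattern_face_hexagon by (auto simp: pentagons_def)

text \<open>Eliminating \<open>card (bd f \<inter> Z)\<close> from \<open>card_bd_defect\<close>
  gives \<open>defect f = 2 * card (bd f - Z) - card (bd f)\<close>. Hence at least three edges are
  off \<open>Z\<close>, and \<open>t\<close> counts those beyond three, each adding 2 to the least
  possible defect.\<close>

lemma defect_excess:
  assumes f: "f \<in> F - P"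
  obtains t where "defect f = (if f \<in> pentagons then 1 else 0) + 2 * t" "card (bd f - Z) = 3 + t"
proof -
  have fF: "f \<in> F"
    using f by blast
  have bd_eq: "card (bd f) = card (bd f \<inter> Z) + card (bd f - Z)"
    using finite_bd[OF fF] by (metis card_Int_Diff)
  show ?thesis
  proof (rule that[of "card (bd f - Z) - 3"])
    show "defect f = (if f \<in> pentagons then 1 else 0) + 2 * (card (bd f - Z) - 3)"
      "card (bd f - Z) = 3 + (card (bd f - Z) - 3)"
      using bd_eq card_bd_defect[OF f] bd(2)[OF fF] fF by (auto simp: pentagons_def)
  qed
qed

lemma pentagons_le: "card pentagons \<le> card U"
proof -
  have "card pentagons = (\<Sum>f\<in>pentagons. 1)"
    by simp
  also have "\<dots> \<le> (\<Sum>f\<in>pentagons. defect f)"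
  proof (rule sum_mono)
    fix f assume f: "f \<in> pentagons"
    then have "f \<in> F - P"
      using pentagons_off_pattern by blast
    from defect_excess[OF this] show "1 \<le> defect f"
      using f by (metis le_add1)
  qed
  also have "\<dots> \<le> (\<Sum>f\<in>F - P. defect f)"
    using pentagons_off_pattern finite by (intro sum_mono2) auto
  finally show ?thesis
    by (simp add: sum_defect)
qed

text \<open>
  The edge set \<open>sym_diff M EP\<close> is again a perfect matching, so its complement is a 2-factor and
  hence a face cut.
\<close>

lemma cut_off_pattern:
  obtains A where "A \<subseteq> F" "\<And>e. e \<in> E - Z \<Longrightarrow> odd (card {f \<in> A. e \<in> bd f})"
proof -
  let ?N = "sym_diff M EP"
  have N: "?N \<subseteq> E"
    using M EP by auto
  have "even (deg (E - ?N) v)" if v: "v \<in> V" for v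
  proof -
    \<comment> \<open>Parity suffices: \<open>M\<close> has degree 1, while \<open>EP\<close> has
      degree 0 on \<open>U\<close> and 2 elsewhere.\<close>
    have "odd (deg ?N v)"
    proof -
      have "even (deg EP v)"
      proof (cases "v \<in> U")
        case True
        then show ?thesis
          unfolding deg_def EP_at_U[OF True] by simp
      next
        case False
        then obtain h where "h \<in> P" "v \<in> vs h"
          using v by (auto simp: U_def)
        then have "deg EP v = deg (bd h) v" "deg (bd h) v = 2"
          using EP_at_pattern_face(1) deg_bd[OF _ v] P by (auto simp: deg_def)
        then show ?thesis by simp
      qed
      then show ?thesis
        using even_deg_sym_diff[OF M EP] deg_M[OF v] by simp
    qed
    moreover have "sym_diff E ?N = E - ?N"
      using N by blast
    moreover have "odd (deg E v)"
      using cubic[OF v] by (simp add: deg_def)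
    ultimately show ?thesis
      using even_deg_sym_diff[OF subset_refl N, of v] by simp
  qed
  then obtain A where "A \<subseteq> F" "\<And>e. e \<in> E \<Longrightarrow> e \<in> E - ?N \<longleftrightarrow> odd (card {f \<in> A. e \<in> bd f})"
    using cut[of "E - ?N"] by (auto simp: deg_def)
  \<comment> \<open>The set \<open>sym_diff M EP\<close> is contained in \<open>Z\<close>, so the
    cut contains every edge off \<open>Z\<close>.\<close>
  then show ?thesis
    using that[of A] by (auto simp: Z_def)
qed

text \<open>Double counting. Pattern faces have all their edges in \<open>Z\<close>, so the one face
  of \<open>A\<close> at an edge off \<open>Z\<close> lies off \<open>P\<close>.\<close>

lemma sum_bd_off_pattern:
  assumes A: "A \<subseteq> F" "\<And>e. e \<in> E - Z \<Longrightarrow> card {f \<in> A. e \<in> bd f} = 1"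
  shows "(\<Sum>f\<in>A - P. card (bd f - Z)) = card (E - Z)"
proof -
  have "(\<Sum>f\<in>A - P. card (bd f - Z)) = (\<Sum>f\<in>A - P. card {e \<in> E - Z. e \<in> bd f})"
    using A(1) bd(1) by (intro sum.cong refl arg_cong[of _ _ card]) blast
  also have "\<dots> = (\<Sum>e\<in>E - Z. card {f \<in> A - P. e \<in> bd f})"
    using A(1) finite finite_subset by (intro sum_card_filter_swap) auto
  also have "\<dots> = (\<Sum>e\<in>E - Z. 1)"
  proof (rule sum.cong)
    fix e assume e: "e \<in> E - Z"
    then have "{f \<in> A - P. e \<in> bd f} = {f \<in> A. e \<in> bd f}"
      by (auto simp: Z_def EP_def)
    then show "card {f \<in> A - P. e \<in> bd f} = 1"
      using A(2)[OF e] by simp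
  qed simp
  finally show ?thesis by simp
qed

text \<open>
  If \<open>|U|\<close> exceeded the number of pentagons by two, all faces off the pattern would carry three edges
  off \<open>Z\<close>, except one with four. Both sides of the cut carry all edges off \<open>Z\<close>, which is
  impossible modulo 3.
\<close>

lemma card_U_neq: "card U \<noteq> card pentagons + 2"
proof
  assume U: "card U = card pentagons + 2"
  have "\<forall>f\<in>F - P. \<exists>t. defect f = (if f \<in> pentagons then 1 else 0) + 2 * t \<and> card (bd f - Z) = 3 + t"
    using defect_excess by metis
  then obtain t where t: "\<And>f. f \<in> F - P \<Longrightarrow> defect f = (if f \<in> pentagons then 1 else 0) + 2 * t f"
      "\<And>f. f \<in> F - P \<Longrightarrow> card (bd f - Z) = 3 + t f"
    by metis
  have pent: "{f \<in> F - P. f \<in> pentagons} = pentagons"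
    using pentagons_off_pattern by blast
  have "card U = (\<Sum>f\<in>F - P. (if f \<in> pentagons then 1 else 0) + 2 * t f)"
    using t(1) by (simp flip: sum_defect)
  also have "\<dots> = card pentagons + 2 * (\<Sum>f\<in>F - P. t f)"
    using finite pent by (simp add: sum.distrib sum.If_cases sum_distrib_left Int_def)
  finally have sum_t: "(\<Sum>f\<in>F - P. t f) = 1"
    using U by simp
  obtain A where A: "A \<subseteq> F" "\<And>e. e \<in> E - Z \<Longrightarrow> odd (card {f \<in> A. e \<in> bd f})"
    using cut_off_pattern by metis
  have finA: "finite A"
    using A(1) finite finite_subset by blast
  \<comment> \<open>The count in \<open>A\<close> is odd and the two counts add up to 2, so both are
    1.\<close>
  have one: "card {f \<in> A. e \<in> bd f} = 1" "card {f \<in> F - A. e \<in> bd f} = 1" if e: "e \<in> E - Z" for e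
  proof -
    have "card {f \<in> F. e \<in> bd f} = card ({f \<in> A. e \<in> bd f} \<union> {f \<in> F - A. e \<in> bd f})"
      using A(1) by (intro arg_cong[of _ _ card]) auto
    also have "\<dots> = card {f \<in> A. e \<in> bd f} + card {f \<in> F - A. e \<in> bd f}"
      using finite finA by (intro card_Un_disjoint) auto
    finally have "card {f \<in> A. e \<in> bd f} + card {f \<in> F - A. e \<in> bd f} = 2"
      using two_faces e by simp
    then show "card {f \<in> A. e \<in> bd f} = 1" "card {f \<in> F - A. e \<in> bd f} = 1"
      using A(2)[OF e] by presburger+
  qed
  have sum3: "(\<Sum>f\<in>B - P. card (bd f - Z)) = 3 * card (B - P) + (\<Sum>f\<in>B - P. t f)" if "B \<subseteq> F" for B
  proof -
    have "(\<Sum>f\<in>B - P. card (bd f - Z)) = (\<Sum>f\<in>B - P. 3 + t f)"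
      using that t(2) by (intro sum.cong) auto
    then show ?thesis
      by (simp add: sum.distrib)
  qed
  have "(\<Sum>f\<in>A - P. t f) + (\<Sum>f\<in>F - A - P. t f) = (\<Sum>f\<in>(A - P) \<union> (F - A - P). t f)"
    using finA finite by (intro sum.union_disjoint[symmetric]) auto
  also have "(A - P) \<union> (F - A - P) = F - P"
    using A(1) by blast
  finally have "(\<Sum>f\<in>A - P. t f) + (\<Sum>f\<in>F - A - P. t f) = 1"
    using sum_t by simp
  moreover have "3 * card (A - P) + (\<Sum>f\<in>A - P. t f) = card (E - Z)"
    unfolding sum3[OF A(1), symmetric] by (rule sum_bd_off_pattern[OF A(1) one(1)])
  moreover have "3 * card (F - A - P) + (\<Sum>f\<in>F - A - P. t f) = card (E - Z)"
    unfolding sum3[OF Diff_subset, symmetric] by (rule sum_bd_off_pattern[OF Diff_subset one(2)])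
  moreover have False if "x + y = 1" "3 * a + x = z" "3 * b + y = z" for a b x y z :: nat
    using that by presburger
  ultimately show False
    by blast
qed

text \<open>By \<open>card_V\<close> the number \<open>card U\<close> is congruent to
  \<open>card V\<close> modulo 6, and it is at least the number \<open>6 * c\<close> of pentagons.
  In the residue class 2 this leaves 14 or at least 20, and 14 forces \<open>c = 2\<close>, the case
  excluded by \<open>card_U_neq\<close>.\<close>

lemma card_pattern_le: "6 * card P + (if card V mod 6 = 2 then 20 else 12) \<le> card V"
proof -
  obtain c where c: "c \<ge> 2" "card pentagons = 6 * c"
    using card_pentagons by metis
  have ge: "12 \<le> card U"
    using c pentagons_le by linarith
  have "20 \<le> card U" if "card V mod 6 = 2"
  proof (rule ccontr)
    assume "\<not> 20 \<le> card U"
    moreover have "card U mod 6 = 2"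
      using that card_V by simp
    ultimately have "card U = 14"
      using ge by presburger
    moreover from this have "c = 2"
      using c pentagons_le by linarith
    ultimately show False
      using card_U_neq c by simp
  qed
  then show ?thesis
    using ge card_V by simp
qed

end

section \<open>Clar number\<close>

context fullerene_graph
begin

text \<open>Induction on \<open>C\<close>: split off a cycle and add the faces inside it modulo 2.\<close>

lemma even_subgraph_cut:
  assumes "C \<subseteq> E" and "\<And>v. v \<in> V \<Longrightarrow> even (card {e \<in> C. v \<in> e})"
  shows "\<exists>A\<subseteq>faces V E. \<forall>e\<in>E. e \<in> C \<longleftrightarrow> odd (card {f \<in> A. e \<in> face_edges E f})"
  using assms
proof (induction "card C" arbitrary: C rule: less_induct)
  case less
  note finE = plane_graphD(2)[OF plane]
  have finC: "finite C"
    using less.prems(1) finE finite_subset by blast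
  show ?case
  proof (cases "C = {}")
    case True
    then show ?thesis
      by (intro exI[of _ "{}"]) simp
  next
    case False
    obtain k v e where k: "k \<ge> 3" "inj_on v {..<k}"
      and e: "\<And>i. i < k \<Longrightarrow> e i \<in> C \<and> e i \<inter> V = {v i, v (Suc i mod k)}"
    proof (rule exists_polygon[of V C "\<lambda>e. e \<inter> V"])
      show "finite V" "finite C" "C \<noteq> {}"
        using finC False plane_graphD(1)[OF plane] by auto
      show "inj_on (\<lambda>e. e \<inter> V) C"
        using less.prems(1) plane_graphD(3)[OF plane] by (meson inj_onI subsetD)
      show "e \<inter> V \<subseteq> V \<and> card (e \<inter> V) = 2" if "e \<in> C" for e
        using plane_graph_edge(2)[OF plane] less.prems(1) that by blast
      show "card {e \<in> C. v \<in> e \<inter> V} \<noteq> 1" if "v \<in> V" for v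
        using less.prems(2)[OF that] that by (metis (no_types, lifting) Collect_cong IntI IntD1 odd_one)
    qed (use that in blast)
    define Q where "Q = e ` {..<k}"
    have QC: "Q \<subseteq> C"
      using e by (auto simp: Q_def)
    have eE: "\<And>i. i < k \<Longrightarrow> e i \<in> E \<and> e i \<inter> V = {v i, v (Suc i mod k)}"
      using e less.prems(1) by blast
    have Q: "plane_cycle V E Q" "\<And>x. x \<in> V \<Longrightarrow> card {q \<in> Q. x \<in> q} \<in> {0, 2}"
      using polygon_plane_cycle(1,3)[OF plane k eE] by (simp_all add: Q_def)
    have "Q \<noteq> {}"
      using Q(1) by (simp add: plane_cycle_def)
    then have "card (C - Q) < card C"
      using QC finC by (intro psubset_card_mono) auto
    moreover have "even (card {e \<in> C - Q. v \<in> e})" if v: "v \<in> V" for v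
    proof -
      have "{e \<in> C - Q. v \<in> e} = {e \<in> C. v \<in> e} - {e \<in> Q. v \<in> e}"
        by blast
      also have "card \<dots> = card {e \<in> C. v \<in> e} - card {e \<in> Q. v \<in> e}"
        using QC finite_subset[OF QC finC] by (intro card_Diff_subset) auto
      finally show ?thesis
        using less.prems(2)[OF v] Q(2)[OF v] by auto
    qed
    ultimately obtain A where A: "A \<subseteq> faces V E"
        "\<And>e. e \<in> E \<Longrightarrow> e \<in> C - Q \<longleftrightarrow> odd (card {f \<in> A. e \<in> face_edges E f})"
      using less.hyps[of "C - Q"] less.prems(1) by blast
    define B where "B = {f \<in> faces V E. f \<subseteq> inside (\<Union>Q)}"
    have B: "e \<in> Q \<longleftrightarrow> odd (card {f \<in> B. e \<in> face_edges E f})" if "e \<in> E" for e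
      using cycle_bounds[OF Q(1), of e] that unfolding B_def by fastforce
    have "e \<in> C \<longleftrightarrow> odd (card {f \<in> sym_diff A B. e \<in> face_edges E f})" if e: "e \<in> E" for e
    proof -
      have eq: "{f \<in> sym_diff A B. e \<in> face_edges E f}
          = sym_diff {f \<in> A. e \<in> face_edges E f} {f \<in> B. e \<in> face_edges E f}"
        by blast
      have "finite {f \<in> A. e \<in> face_edges E f}" "finite {f \<in> B. e \<in> face_edges E f}"
        using finite_subset[OF A(1) finite_faces] finite_faces by (simp_all add: B_def)
      then have "odd (card {f \<in> sym_diff A B. e \<in> face_edges E f}) \<longleftrightarrow> (e \<in> C - Q \<longleftrightarrow> e \<notin> Q)"
        unfolding eq A(2)[OF e] B[OF e] by (simp only: even_card_sym_diff) blast
      then show ?thesis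
        using QC by blast
    qed
    moreover have "sym_diff A B \<subseteq> faces V E"
      using A(1) by (auto simp: B_def)
    ultimately show ?thesis
      by blast
  qed
qed

lemma ends_cong: "v \<in> V \<Longrightarrow> {e \<in> D. v \<in> e \<inter> V} = {e \<in> D. v \<in> e}"
  by blast

section \<open>Plane fullerenes as combinatorial maps\<close>

sublocale fullerene_map V E "faces V E" "\<lambda>e. e \<inter> V" "face_edges E"
proof
  show "finite V" "finite E" "finite (faces V E)"
    using plane_graphD[OF plane] finite_faces by auto
  show "V \<noteq> {}"
  proof
    \<comment> \<open>Every edge has two vertices, so there would be no edges; yet some face exists,
      and its boundary cycle has edges.\<close>
    assume "V = {}"
    then have "E = {}"
      using plane_graph_edge(2)[OF plane] by fastforce
    then obtain f where "f \<in> faces V E"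
      using face_through_point[of 0 V E] \<open>V = {}\<close> by auto
    then show False
      using face_boundary(1) \<open>E = {}\<close> by (auto simp: plane_cycle_def)
  qed
  show "card (e \<inter> V) = 2" if "e \<in> E" for e
    using plane_graph_edge(2)[OF plane that] .
  show "card {e \<in> E. v \<in> e \<inter> V} = 3" if "v \<in> V" for v
    using fullerene that unfolding ends_cong[OF that] by (simp add: fullerene_def trivalent_def)
  show "face_edges E f \<subseteq> E" for f
    by (auto simp: face_edges_def)
  show "card (face_edges E f) \<in> {5, 6}" if "f \<in> faces V E" for f
    using face_boundary(3)[OF that] .
  show "card {e \<in> face_edges E f. v \<in> e \<inter> V} \<in> {0, 2}" if "f \<in> faces V E" "v \<in> V" for f v
    using face_boundary(4)[OF that] unfolding ends_cong[OF that(2)] .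
  show "card {f \<in> faces V E. e \<in> face_edges E f} = 2" if "e \<in> E" for e
    using edge_two_faces[OF that] .
  show "\<exists>A\<subseteq>faces V E. \<forall>e\<in>E. e \<in> C \<longleftrightarrow> odd (card {f \<in> A. e \<in> face_edges E f})"
    if "C \<subseteq> E" "\<And>v. v \<in> V \<Longrightarrow> even (card {e \<in> C. v \<in> e \<inter> V})" for C
  proof (rule even_subgraph_cut[OF that(1)])
    show "even (card {e \<in> C. v \<in> e})" if v: "v \<in> V" for v
      using \<open>\<And>v. v \<in> V \<Longrightarrow> even (card {e \<in> C. v \<in> e \<inter> V})\<close>[OF v] unfolding ends_cong[OF v] .
  qed
qed simp

lemma vs_eq_face_vertices:
  assumes "f \<in> faces V E"
  shows "vs f = face_vertices V f"
  unfolding vs_def face_vertices_def face_boundary(2)[OF assms, symmetric] by blast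

lemma resonant_pattern_card_le:
  assumes "resonant_pattern V E P"
  shows "6 * card P + (if card V mod 6 = 2 then 20 else 12) \<le> card V"
proof -
  obtain M where P: "P \<subseteq> faces V E" "pairwise (\<lambda>f g. disjnt (face_vertices V f) (face_vertices V g)) P"
    and M: "perfect_matching V E M" "\<forall>f\<in>P. alternating_face E M f"
    using assms by (auto simp: resonant_pattern_def)
  interpret resonant_map V E "faces V E" "\<lambda>e. e \<inter> V" "face_edges E" P M
  proof
    show "P \<subseteq> faces V E" "M \<subseteq> E"
      using P M by (auto simp: perfect_matching_def)
    show "\<exists>!e. e \<in> M \<and> v \<in> e \<inter> V" if "v \<in> V" for v
      using M(1) that by (simp add: perfect_matching_def)
    show "2 * card (face_edges E f \<inter> M) = card (face_edges E f)" if "f \<in> P" for f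
      using M(2) that by (simp add: alternating_face_def)
    show "vs f \<inter> vs g = {}" if "f \<in> P" "g \<in> P" "f \<noteq> g" for f g
      using P that vs_eq_face_vertices by (metis disjnt_def pairwiseD subsetD)
  qed
  show ?thesis
    by (rule card_pattern_le)
qed

text \<open>Ensures \<open>n div 6 \<ge> 3\<close>, so that truncated subtraction in the bound
  agrees with integer subtraction.\<close>

lemma card_V_ge_20: "card V \<ge> 20"
proof -
  obtain c where "c \<ge> 2" "10 * c \<le> card V"
    using card_pentagons by metis
  then show ?thesis
    by linarith
qed

end

theorem theorem1p2:
  fixes V :: "complex set" and E :: "complex set set" and n :: nat
  assumes "fullerene V E" and "card V = n"
  shows "int (clar_number V E) \<le>
    (if n mod 6 = 2 then \<lfloor>real n / 6\<rfloor> - 3 else \<lfloor>real n / 6\<rfloor> - 2)"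
proof -
  interpret fullerene_graph V E
    by unfold_locales (rule assms(1))
  define b where "b = (if n mod 6 = 2 then n div 6 - 3 else n div 6 - 2)"
  have le: "x \<le> b" if x: "x \<in> {card P | P. resonant_pattern V E P}" for x
  proof -
    obtain P where "resonant_pattern V E P" "x = card P"
      using x by blast
    then show ?thesis
      using resonant_pattern_card_le[of P] assms(2) unfolding b_def by (auto split: if_splits)
  qed
  have "clar_number V E \<le> b"
  \<comment> \<open>The set is empty exactly when there is no perfect matching, since otherwise the
    empty pattern is resonant; its \<open>Sup\<close> is then 0.\<close>
  proof (cases "{card P | P. resonant_pattern V E P} = {}")
    case True
    show ?thesis
      unfolding clar_number_def True by (simp add: Sup_nat_def)
  next
    case False
    then show ?thesis
      unfolding clar_number_def using le by (rule cSup_least)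
  qed
  moreover have "n div 6 \<ge> 3"
    using card_V_ge_20 assms(2) by linarith
  moreover have "\<lfloor>real n / 6\<rfloor> = int (n div 6)"
    using floor_divide_of_nat_eq[of n 6] by simp
  ultimately show ?thesis
    by (auto simp: b_def split: if_splits)
qed

end
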